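(* Let $(\mathcal{B},\mu,\mathbf 1,\Delta,\delta)$ be a bialgebra. (A) Let $L\in B_2^{(\mathbf{NC})}$, $L=\partial\psi$ with $\psi\in C_1^{(\mathbf{NC})}$. For $t\ge 0$ put $\Phi_t=\mathrm{id}\star e_\star^{-t\psi}$ and $\mu_t=\mu\star e_\star^{tL}$. Then $(\Phi_t)_{t\geq 0}$ is a pointwise continuous semigroup of unital algebra isomorphisms $\Phi_t:(\mathcal{B},\mu)\to(\mathcal{B},\mu_t)$ for which $$(\Phi_t\otimes\mathrm{id})\circ\Delta=(\mathrm{id}\otimes\Phi_t)\circ\Delta\quad\text{for all }t\geq 0.$$ If $\mathcal{B}$ is a $*$-bialgebra and $L\in B_2^{(\mathbf{NCH})}$, then $\psi$ can be chosen in $C_1^{(\mathbf{NCH})}$, and then the $\Phi_t$ are $*$-algebra isomorphisms. (B) Conversely, let $(\Phi_t)_{t\geq 0}$ be a pointwise continuous semigroup of invertible linear mappings $\Phi_t:\mathcal{B}\to\mathcal{B}$ such that $\Phi_t(\mathbf 1)=\mathbf 1$ and $(\Phi_t\otimes\mathrm{id})\circ\Delta=(\mathrm{id}\otimes\Phi_t)\circ\Delta$ for all $t\ge 0$. Then $$\mu_t:=\Phi_t\circ\mu\circ(\Phi_t^{-1}\otimes\Phi_t^{-1})$$ defines an additive deformation $(\mu_t)_{t\ge0}$ of $\mathcal{B}$ whose generator $L$ lies in $B_2^{(\mathbf{NC})}$. If $\mathcal{B}$ is a $*$-bialgebra and the $\Phi_t$ are hermitian, then $(\mu_t)_{t\ge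 0}$ is an additive deformation of a $*$-bialgebra and $L\in B_2^{(\mathbf{NCH})}$.
   Context: All vector spaces are over $\mathbb{C}$. In a bialgebra $(\mathcal{B},\mu,\mathbf 1,\Delta,\delta)$, $\mu$ is the multiplication, $\mathbf 1$ the unit, $\Delta$ the comultiplication, $\delta$ the counit; $\tau$ is the flip on $\mathcal B\otimes\mathcal B$; $\Delta a=a_{(1)}\otimes a_{(2)}$ (Sweedler). A $*$-bialgebra is a bialgebra with an involution $*$ making $\mathcal{B}$ a unital $*$-algebra such that $\Delta,\delta$ are $*$-homomorphisms, where $(a\otimes b)^*=a^*\otimes b^*$. $\mathcal{B}\otimes\mathcal{B}$ has comultiplication $(\mathrm{id}\otimes\tau\otimes\mathrm{id})\circ(\Delta\otimes\Delta)$ and counit $\delta\otimes\delta$. Convolution: for linear maps $R,S$ from a coalgebra $(\mathcal C,\Delta_{\mathcal C})$ to an algebra with product $m$, $R\star S=m\circ(R\otimes S)\circ\Delta_{\mathcal C}$; scalar-valued maps may be convolved with $\mathcal B$-valued ones in the same way. E.g. $(\mathrm{id}\star\varphi)(a)=a_{(1)}\varphi(a_{(2)})$ and $(\mu\star L)(a\otimes b)=a_{(1)}b_{(1)}L(a_{(2)}\otimes b_{(2)})$. For a linear functional $f$ on a coalgebra, $e_\star^{f}=\sum_{n\ge0}f^{\star n}/n!$ (pointwise convergent), $f^{\star 0}$ being the counit. For a linear functional $\psi:\mathcal{B}\to\mathbb{C}$, $\partial\psi:\mathcal{B}\otimes\mathcal{B}\to\mathbb{C}$ is $\partial\psi(a\otimes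 b)=\delta(a)\psi(b)-\psi(ab)+\psi(a)\delta(b)$. $C_1^{(\mathbf{NC})}$ is the set of linear $\psi:\mathcal{B}\to\mathbb{C}$ with $\psi(\mathbf 1)=0$ and $\psi\star\mathrm{id}=\mathrm{id}\star\psi$. If $\mathcal{B}$ is a $*$-bialgebra, $C_1^{(\mathbf{NCH})}$ is the set of those $\psi\in C_1^{(\mathbf{NC})}$ which are hermitian, $\psi(a)=\overline{\psi(a^* )}$. $B_2^{(\mathbf{NC})}=\partial C_1^{(\mathbf{NC})}$ and $B_2^{(\mathbf{NCH})}=\partial C_1^{(\mathbf{NCH})}$. An additive deformation of $\mathcal{B}$ is a family $(\mu_t)_{t\ge0}$ of linear maps $\mu_t:\mathcal{B}\otimes\mathcal{B}\to\mathcal{B}$ such that: $(\mathcal{B},\mu_t,\mathbf 1)$ is a unital (associative) algebra for each $t\geq 0$; $\mu_0=\mu$; $\Delta\circ\mu_{t+s}=(\mu_t\otimes\mu_s)\circ(\mathrm{id}\otimes\tau\otimes\mathrm{id})\circ(\Delta\otimes\Delta)$ for all $s,t\ge0$; and $\delta\circ\mu_t\to\delta\otimes\delta$ pointwise as $t\to0$. It is an additive deformation of a $*$-bialgebra if $\mathcal{B}$ is a $*$-bialgebra and each $(\mathcal{B},\mu_t,\mathbf 1,* )$ is a unital $*$-algebra. Its generator is the pointwise derivative $L=\frac{\mathrm d}{\mathrm dt}(\delta\circ\mu_t)|_{t=0}$ (which always exists). A semigroup $(\Phi_t)_{t\geq0}$ of linear maps on $\mathcal B$ satisfies $\Phi_0=\mathrm{id}$,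 $\Phi_s\circ\Phi_t=\Phi_{s+t}$. It is pointwise continuous if for each $b\in\mathcal{B}$, $\Phi_t(b)\to b$ as $t\to0$, meaning $f(\Phi_t(b))\to f(b)$ for every linear functional $f$ on $\mathcal{B}$ (for maps satisfying $(\Phi_t\otimes\mathrm{id})\circ\Delta=(\mathrm{id}\otimes\Phi_t)\circ\Delta$, all $\Phi_t(b)$ with $b$ fixed lie in one finite-dimensional subspace). $\Phi_t$ is hermitian if $\Phi_t(b^* )=\Phi_t(b)^*$ for all $b$. *)

theory Defs
  imports "HOL-Analysis.Analysis" "HOL-Library.Poly_Mapping"
begin

section \<open>Complex vector spaces\<close>

class complex_vector = ab_group_add +
  fixes scaleC :: "complex \<Rightarrow> 'a \<Rightarrow> 'a"  (infixr "*\<^sub>C" 75)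
  assumes scaleC_add_right: "c *\<^sub>C (x + y) = c *\<^sub>C x + c *\<^sub>C y"
    and scaleC_add_left: "(c + d) *\<^sub>C x = c *\<^sub>C x + d *\<^sub>C x"
    and scaleC_scaleC: "c *\<^sub>C d *\<^sub>C x = (c * d) *\<^sub>C x"
    and scaleC_one: "1 *\<^sub>C x = x"

global_interpretation cvec: vector_space "scaleC :: complex \<Rightarrow> 'a \<Rightarrow> 'a::complex_vector"
  by unfold_locales (simp_all add: scaleC_add_right scaleC_add_left scaleC_scaleC scaleC_one)

abbreviation clinear :: "('a::complex_vector \<Rightarrow> 'b::complex_vector) \<Rightarrow> bool" where
  "clinear \<equiv> Vector_Spaces.linear scaleC scaleC"

definition antilinear :: "('a::complex_vector \<Rightarrow> 'b::complex_vector) \<Rightarrow> bool" where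
  "antilinear f \<longleftrightarrow> (\<forall>x y. f (x + y) = f x + f y) \<and> (\<forall>c x. f (c *\<^sub>C x) = cnj c *\<^sub>C f x)"

instantiation complex :: complex_vector
begin

definition scaleC_complex :: "complex \<Rightarrow> complex \<Rightarrow> complex" where
  "scaleC_complex c z = c * z"

instance
  by standard (simp_all add: scaleC_complex_def algebra_simps)

end

instantiation poly_mapping :: (type, complex_vector) complex_vector
begin

definition scaleC_poly_mapping :: "complex \<Rightarrow> ('a \<Rightarrow>\<^sub>0 'b) \<Rightarrow> ('a \<Rightarrow>\<^sub>0 'b)" where
  "scaleC_poly_mapping c p = Poly_Mapping.map (scaleC c) p"

lemma lookup_scaleC: "Poly_Mapping.lookup (c *\<^sub>C p) k = c *\<^sub>C Poly_Mapping.lookup p k"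
  unfolding scaleC_poly_mapping_def
  by (simp add: Poly_Mapping.map.rep_eq when_def)

instance
  by standard
    (rule poly_mapping_eqI;
     simp add: lookup_scaleC lookup_add scaleC_add_right scaleC_add_left scaleC_scaleC scaleC_one)+

end

section \<open>The algebraic tensor product\<close>

text \<open>
  The tensor product is the free vector space on \<open>'a \<times> 'b\<close> (finitely supported functions into the
  complex numbers) modulo the subspace spanned by the bilinearity relations.
\<close>

inductive_set tensor_relations :: "('a::complex_vector \<times> 'b::complex_vector \<Rightarrow>\<^sub>0 complex) set" where
  "Poly_Mapping.single (a + a', b) 1 - Poly_Mapping.single (a, b) 1 - Poly_Mapping.single (a', b) 1
     \<in> tensor_relations"
| "Poly_Mapping.single (a, b + b') 1 - Poly_Mapping.single (a, b) 1 - Poly_Mapping.single (a, b') 1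
     \<in> tensor_relations"
| "Poly_Mapping.single (c *\<^sub>C a, b) 1 - c *\<^sub>C Poly_Mapping.single (a, b) 1 \<in> tensor_relations"
| "Poly_Mapping.single (a, c *\<^sub>C b) 1 - c *\<^sub>C Poly_Mapping.single (a, b) 1 \<in> tensor_relations"

definition tensor_rel :: "('a::complex_vector \<times> 'b::complex_vector \<Rightarrow>\<^sub>0 complex) \<Rightarrow>
    ('a \<times> 'b \<Rightarrow>\<^sub>0 complex) \<Rightarrow> bool" where
  "tensor_rel x y \<longleftrightarrow> x - y \<in> cvec.span tensor_relations"

lemma equivp_tensor_rel: "equivp tensor_rel"
proof (rule equivpI)
  show "reflp tensor_rel"
    by (rule reflpI) (simp add: tensor_rel_def cvec.span_zero)
  show "symp tensor_rel"
    by (rule sympI) (metis tensor_rel_def cvec.span_neg minus_diff_eq)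
  show "transp tensor_rel"
  proof (rule transpI)
    show "tensor_rel x z" if "tensor_rel x y" "tensor_rel y z" for x y z
      using cvec.span_add[OF that[unfolded tensor_rel_def]] by (simp add: tensor_rel_def)
  qed
qed

quotient_type (overloaded) ('a, 'b) tensor  (infixr "\<otimes>" 70)
  = "('a::complex_vector \<times> 'b::complex_vector) \<Rightarrow>\<^sub>0 complex" / tensor_rel
  by (rule equivp_tensor_rel)

instantiation tensor :: (complex_vector, complex_vector) complex_vector
begin

lift_definition zero_tensor :: "'a \<otimes> 'b" is 0 .

lift_definition plus_tensor :: "'a \<otimes> 'b \<Rightarrow> 'a \<otimes> 'b \<Rightarrow> 'a \<otimes> 'b" is "(+)"
  unfolding tensor_rel_def by (metis add_diff_add cvec.span_add)

lift_definition uminus_tensor :: "'a \<otimes> 'b \<Rightarrow> 'a \<otimes> 'b" is uminus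
  unfolding tensor_rel_def by (drule cvec.span_neg) simp

lift_definition minus_tensor :: "'a \<otimes> 'b \<Rightarrow> 'a \<otimes> 'b \<Rightarrow> 'a \<otimes> 'b" is "(-)"
  unfolding tensor_rel_def by (drule (1) cvec.span_diff) (simp add: algebra_simps)

lift_definition scaleC_tensor :: "complex \<Rightarrow> 'a \<otimes> 'b \<Rightarrow> 'a \<otimes> 'b" is scaleC
  unfolding tensor_rel_def by (metis cvec.span_scale cvec.scale_right_diff_distrib)

instance
  by standard
    (transfer; simp add: tensor_rel_def cvec.span_zero algebra_simps scaleC_add_right
      scaleC_add_left scaleC_scaleC scaleC_one)+

end

lift_definition tensor_elem :: "'a::complex_vector \<Rightarrow> 'b::complex_vector \<Rightarrow> 'a \<otimes> 'b"
    (infixr "\<otimes>\<^sub>e" 70)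
  is "\<lambda>a b. Poly_Mapping.single (a, b) 1" .

lemma tensor_elem_add_left: "(a + a') \<otimes>\<^sub>e b = a \<otimes>\<^sub>e b + a' \<otimes>\<^sub>e b"
  by transfer
    (simp add: tensor_rel_def cvec.span_base tensor_relations.intros diff_diff_eq[symmetric])

lemma tensor_elem_add_right: "a \<otimes>\<^sub>e (b + b') = a \<otimes>\<^sub>e b + a \<otimes>\<^sub>e b'"
  by transfer
    (simp add: tensor_rel_def cvec.span_base tensor_relations.intros diff_diff_eq[symmetric])

lemma tensor_elem_scale_left: "(c *\<^sub>C a) \<otimes>\<^sub>e b = c *\<^sub>C (a \<otimes>\<^sub>e b)"
  by transfer (simp add: tensor_rel_def cvec.span_base tensor_relations.intros)

lemma tensor_elem_scale_right: "a \<otimes>\<^sub>e (c *\<^sub>C b) = c *\<^sub>C (a \<otimes>\<^sub>e b)"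
  by transfer (simp add: tensor_rel_def cvec.span_base tensor_relations.intros)

lemma tensor_induct [case_names elem add scale]:
  fixes x :: "'a::complex_vector \<otimes> 'b::complex_vector"
  assumes elem: "\<And>a b. P (a \<otimes>\<^sub>e b)"
    and add: "\<And>x y. P x \<Longrightarrow> P y \<Longrightarrow> P (x + y)"
    and scale: "\<And>c x. P x \<Longrightarrow> P (c *\<^sub>C x)"
  shows "P x"
proof -
  have zero: "P 0"
    using scale[OF elem, of 0] by simp
  have P_abs: "P (abs_tensor p)" for p :: "'a \<times> 'b \<Rightarrow>\<^sub>0 complex"
  proof (induction p rule: update_induct)
    case const
    then show ?case using zero by (simp add: zero_tensor.abs_eq)
  next
    case (update p k c)
    obtain a b where k: "k = (a, b)" by (cases k)
    have "Poly_Mapping.update k c p = p + c *\<^sub>C Poly_Mapping.single (a, b) 1"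
      using update.hyps
      by (intro poly_mapping_eqI)
        (auto simp: k lookup_add lookup_scaleC lookup_update lookup_single in_keys_iff when_def
          scaleC_complex_def)
    then have "abs_tensor (Poly_Mapping.update k c p) = abs_tensor p + c *\<^sub>C (a \<otimes>\<^sub>e b)"
      by (simp add: plus_tensor.abs_eq scaleC_tensor.abs_eq tensor_elem.abs_eq)
    then show ?case using add scale elem update.IH by simp
  qed
  show ?thesis
    using P_abs by (metis Quotient_abs_rep Quotient_tensor)
qed

text \<open>
  \<open>tensor_lift \<sigma> f\<close> is the universal extension of \<open>f\<close> to the tensor product, linear for
  \<open>\<sigma> = id\<close> and antilinear for \<open>\<sigma> = cnj\<close>. It is computed on the chosen representative, so it is only
  meaningful if \<open>f\<close> is \<open>\<sigma>\<close>-semilinear in both arguments; then \<open>tensor_lift_elem\<close> and its companions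
  below show that it is the expected map.
\<close>

definition free_lift :: "(complex \<Rightarrow> complex) \<Rightarrow> ('i \<Rightarrow> 'c::complex_vector) \<Rightarrow> ('i \<Rightarrow>\<^sub>0 complex) \<Rightarrow> 'c" where
  "free_lift \<sigma> f p = (\<Sum>i\<in>Poly_Mapping.keys p. \<sigma> (Poly_Mapping.lookup p i) *\<^sub>C f i)"

definition tensor_lift :: "(complex \<Rightarrow> complex) \<Rightarrow>
    ('a::complex_vector \<Rightarrow> 'b::complex_vector \<Rightarrow> 'c::complex_vector) \<Rightarrow> 'a \<otimes> 'b \<Rightarrow> 'c" where
  "tensor_lift \<sigma> f t = free_lift \<sigma> (\<lambda>(a, b). f a b) (rep_tensor t)"

definition bisemilinear :: "(complex \<Rightarrow> complex) \<Rightarrow>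
    ('a::complex_vector \<Rightarrow> 'b::complex_vector \<Rightarrow> 'c::complex_vector) \<Rightarrow> bool" where
  "bisemilinear \<sigma> f \<longleftrightarrow>
     (\<forall>a a' b. f (a + a') b = f a b + f a' b) \<and> (\<forall>a b b'. f a (b + b') = f a b + f a b') \<and>
     (\<forall>c a b. f (c *\<^sub>C a) b = \<sigma> c *\<^sub>C f a b) \<and> (\<forall>c a b. f a (c *\<^sub>C b) = \<sigma> c *\<^sub>C f a b)"

context
  fixes \<sigma> :: "complex \<Rightarrow> complex"
  assumes \<sigma>: "\<sigma> = id \<or> \<sigma> = cnj"
begin

lemma \<sigma>_simps: "\<sigma> 0 = 0" "\<sigma> 1 = 1" "\<sigma> (c + d) = \<sigma> c + \<sigma> d" "\<sigma> (c * d) = \<sigma> c * \<sigma> d"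
  using \<sigma> by auto

lemma free_lift_superset:
  assumes "finite K" "Poly_Mapping.keys p \<subseteq> K"
  shows "free_lift \<sigma> f p = (\<Sum>i\<in>K. \<sigma> (Poly_Mapping.lookup p i) *\<^sub>C f i)"
  unfolding free_lift_def using assms
  by (intro sum.mono_neutral_left) (auto simp: in_keys_iff \<sigma>_simps)

lemma free_lift_add: "free_lift \<sigma> f (p + q) = free_lift \<sigma> f p + free_lift \<sigma> f q"
proof -
  let ?K = "Poly_Mapping.keys p \<union> Poly_Mapping.keys q"
  have "Poly_Mapping.keys (p + q) \<subseteq> ?K" by (rule keys_add)
  then show ?thesis
    by (simp add: free_lift_superset[of ?K] lookup_add \<sigma>_simps scaleC_add_left sum.distrib)
qed

lemma free_lift_scale: "free_lift \<sigma> f (c *\<^sub>C p) = \<sigma> c *\<^sub>C free_lift \<sigma> f p"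
proof -
  have "Poly_Mapping.keys (c *\<^sub>C p) \<subseteq> Poly_Mapping.keys p"
    by (auto simp: in_keys_iff lookup_scaleC scaleC_complex_def)
  then show ?thesis
    by (simp add: free_lift_superset[of "Poly_Mapping.keys p"] lookup_scaleC scaleC_complex_def
        \<sigma>_simps cvec.scale_sum_right)
qed

lemma free_lift_diff: "free_lift \<sigma> f (p - q) = free_lift \<sigma> f p - free_lift \<sigma> f q"
  using free_lift_add[of f "p - q" q] by simp

lemma free_lift_single: "free_lift \<sigma> f (Poly_Mapping.single i 1) = f i"
  by (simp add: free_lift_superset[of "{i}"] \<sigma>_simps scaleC_one)

lemma free_lift_span:
  assumes f: "bisemilinear \<sigma> f" and p: "p \<in> cvec.span tensor_relations"
  shows "free_lift \<sigma> (\<lambda>(a, b). f a b) p = 0"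
  using p
proof (induction p rule: cvec.span_induct_alt)
  case base
  then show ?case by (simp add: free_lift_def)
next
  case (step c x y)
  have "free_lift \<sigma> (\<lambda>(a, b). f a b) x = 0"
    using step(1) f
    by (cases rule: tensor_relations.cases)
      (simp_all add: free_lift_diff free_lift_scale free_lift_single bisemilinear_def)
  then show ?case
    using step by (simp add: free_lift_add free_lift_scale)
qed

lemma tensor_lift_abs:
  assumes f: "bisemilinear \<sigma> f"
  shows "tensor_lift \<sigma> f (abs_tensor p) = free_lift \<sigma> (\<lambda>(a, b). f a b) p"
proof -
  have "tensor_rel (rep_tensor (abs_tensor p)) p"
    by (metis Quotient_rep_abs Quotient_tensor equivp_reflp equivp_tensor_rel)
  then have "free_lift \<sigma> (\<lambda>(a, b). f a b) (rep_tensor (abs_tensor p) - p) = 0"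
    using free_lift_span[OF f] by (simp add: tensor_rel_def)
  then show ?thesis by (simp add: tensor_lift_def free_lift_diff)
qed

lemma abs_tensor_cases: obtains p where "(t :: 'a::complex_vector \<otimes> 'b::complex_vector) = abs_tensor p"
  by (metis Quotient_abs_rep Quotient_tensor)

lemma tensor_lift_elem:
  "bisemilinear \<sigma> f \<Longrightarrow> tensor_lift \<sigma> f (a \<otimes>\<^sub>e b) = f a b"
  by (simp add: tensor_elem.abs_eq tensor_lift_abs free_lift_single)

lemma tensor_lift_add:
  "bisemilinear \<sigma> f \<Longrightarrow> tensor_lift \<sigma> f (s + t) = tensor_lift \<sigma> f s + tensor_lift \<sigma> f t"
  by (cases s rule: abs_tensor_cases, cases t rule: abs_tensor_cases)
    (simp add: plus_tensor.abs_eq tensor_lift_abs free_lift_add)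

lemma tensor_lift_scale:
  "bisemilinear \<sigma> f \<Longrightarrow> tensor_lift \<sigma> f (c *\<^sub>C t) = \<sigma> c *\<^sub>C tensor_lift \<sigma> f t"
  by (cases t rule: abs_tensor_cases) (simp add: scaleC_tensor.abs_eq tensor_lift_abs free_lift_scale)

end

lemma tensor_lift_fun_add:
  "tensor_lift \<sigma> (\<lambda>a b. f a b + g a b) t = tensor_lift \<sigma> f t + tensor_lift \<sigma> g t"
  by (simp add: tensor_lift_def free_lift_def case_prod_beta scaleC_add_right sum.distrib)

lemma tensor_lift_fun_scale:
  "tensor_lift \<sigma> (\<lambda>a b. c *\<^sub>C f a b) t = c *\<^sub>C tensor_lift \<sigma> f t"
  by (simp add: tensor_lift_def free_lift_def case_prod_beta scaleC_scaleC mult.commute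
      cvec.scale_sum_right)

definition tensor_map :: "('a::complex_vector \<Rightarrow> 'c::complex_vector) \<Rightarrow>
    ('b::complex_vector \<Rightarrow> 'd::complex_vector) \<Rightarrow> 'a \<otimes> 'b \<Rightarrow> 'c \<otimes> 'd"  (infixr "\<otimes>\<^sub>m" 70) where
  "f \<otimes>\<^sub>m g = tensor_lift id (\<lambda>a b. f a \<otimes>\<^sub>e g b)"

text \<open>The antilinear map \<open>a \<otimes> b \<mapsto> a\<^sup>* \<otimes> b\<^sup>*\<close>; \<open>tensor_map\<close> is only meaningful for linear maps.\<close>

definition tensor_star :: "('a::complex_vector \<Rightarrow> 'a) \<Rightarrow> 'a \<otimes> 'a \<Rightarrow> 'a \<otimes> 'a" where
  "tensor_star st = tensor_lift cnj (\<lambda>a b. st a \<otimes>\<^sub>e st b)"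

definition tensor_assoc :: "('a::complex_vector \<otimes> 'b::complex_vector) \<otimes> 'c::complex_vector \<Rightarrow> 'a \<otimes> 'b \<otimes> 'c" where
  "tensor_assoc = tensor_lift id (\<lambda>x c. tensor_lift id (\<lambda>a b. a \<otimes>\<^sub>e b \<otimes>\<^sub>e c) x)"

text \<open>The map \<open>id \<otimes> \<tau> \<otimes> id\<close>, that is \<open>(a \<otimes> b) \<otimes> (c \<otimes> d) \<mapsto> (a \<otimes> c) \<otimes> (b \<otimes> d)\<close>.\<close>

definition middle_flip :: "('a::complex_vector \<otimes> 'b::complex_vector) \<otimes> ('c::complex_vector \<otimes> 'd::complex_vector)
    \<Rightarrow> ('a \<otimes> 'c) \<otimes> ('b \<otimes> 'd)" where
  "middle_flip = tensor_lift id (\<lambda>x y. tensor_lift id (\<lambda>a b.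
     tensor_lift id (\<lambda>c d. (a \<otimes>\<^sub>e c) \<otimes>\<^sub>e (b \<otimes>\<^sub>e d)) y) x)"

text \<open>
  The identifications of \<open>\<complex> \<otimes> V\<close> and \<open>V \<otimes> \<complex>\<close> with \<open>V\<close>; on \<open>\<complex> \<otimes> \<complex>\<close> both are the
  multiplication of complex numbers.
\<close>

definition scalar_left :: "complex \<otimes> 'a \<Rightarrow> 'a::complex_vector" where
  "scalar_left = tensor_lift id (\<lambda>z a. z *\<^sub>C a)"

definition scalar_right :: "'a \<otimes> complex \<Rightarrow> 'a::complex_vector" where
  "scalar_right = tensor_lift id (\<lambda>a z. z *\<^sub>C a)"

lemma clinear_iff: "clinear f \<longleftrightarrow> (\<forall>x y. f (x + y) = f x + f y) \<and> (\<forall>c x. f (c *\<^sub>C x) = c *\<^sub>C f x)"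
  by (auto simp: Vector_Spaces.linear_iff cvec.vector_space_axioms)

lemma bisemilinear_tensor_map:
  "clinear f \<Longrightarrow> clinear g \<Longrightarrow> bisemilinear id (\<lambda>a b. f a \<otimes>\<^sub>e g b)"
  by (simp add: clinear_iff bisemilinear_def tensor_elem_add_left tensor_elem_add_right
      tensor_elem_scale_left tensor_elem_scale_right)

lemma tensor_map_elem: "clinear f \<Longrightarrow> clinear g \<Longrightarrow> (f \<otimes>\<^sub>m g) (a \<otimes>\<^sub>e b) = f a \<otimes>\<^sub>e g b"
  by (simp add: tensor_map_def tensor_lift_elem bisemilinear_tensor_map)

lemma clinear_tensor_map: "clinear f \<Longrightarrow> clinear g \<Longrightarrow> clinear (f \<otimes>\<^sub>m g)"
  by (subst clinear_iff)
    (simp add: tensor_map_def tensor_lift_add tensor_lift_scale bisemilinear_tensor_map)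

lemma bisemilinear_tensor_star:
  "antilinear st \<Longrightarrow> bisemilinear cnj (\<lambda>a b. st a \<otimes>\<^sub>e st b)"
  by (simp add: antilinear_def bisemilinear_def tensor_elem_add_left tensor_elem_add_right
      tensor_elem_scale_left tensor_elem_scale_right)

lemma tensor_star_elem: "antilinear st \<Longrightarrow> tensor_star st (a \<otimes>\<^sub>e b) = st a \<otimes>\<^sub>e st b"
  by (simp add: tensor_star_def tensor_lift_elem bisemilinear_tensor_star)

lemma antilinear_tensor_star: "antilinear st \<Longrightarrow> antilinear (tensor_star st)"
  by (subst antilinear_def)
    (simp add: tensor_star_def tensor_lift_add tensor_lift_scale bisemilinear_tensor_star)

lemma bisemilinear_assoc_inner: "bisemilinear id (\<lambda>a b. a \<otimes>\<^sub>e b \<otimes>\<^sub>e c)"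
  by (simp add: bisemilinear_def tensor_elem_add_left tensor_elem_add_right
      tensor_elem_scale_left tensor_elem_scale_right)

lemma bisemilinear_assoc: "bisemilinear id (\<lambda>x c. tensor_lift id (\<lambda>a b. a \<otimes>\<^sub>e b \<otimes>\<^sub>e c) x)"
  by (subst bisemilinear_def, simp only: tensor_lift_add tensor_lift_scale bisemilinear_assoc_inner
      tensor_elem_add_right tensor_elem_scale_right tensor_lift_fun_add tensor_lift_fun_scale id_apply simp_thms)

lemma tensor_assoc_elem: "tensor_assoc ((a \<otimes>\<^sub>e b) \<otimes>\<^sub>e c) = a \<otimes>\<^sub>e b \<otimes>\<^sub>e c"
  by (simp add: tensor_assoc_def tensor_lift_elem bisemilinear_assoc bisemilinear_assoc_inner)

lemma clinear_tensor_assoc: "clinear tensor_assoc"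
  by (subst clinear_iff) (simp add: tensor_assoc_def tensor_lift_add tensor_lift_scale bisemilinear_assoc)

lemma bisemilinear_flip1: "bisemilinear id (\<lambda>c d. (a \<otimes>\<^sub>e c) \<otimes>\<^sub>e (b \<otimes>\<^sub>e d))"
  by (simp add: bisemilinear_def tensor_elem_add_left tensor_elem_add_right
      tensor_elem_scale_left tensor_elem_scale_right)

lemma bisemilinear_flip2:
  "bisemilinear id (\<lambda>a b. tensor_lift id (\<lambda>c d. (a \<otimes>\<^sub>e c) \<otimes>\<^sub>e (b \<otimes>\<^sub>e d)) y)"
  by (simp add: bisemilinear_def tensor_elem_add_left tensor_elem_add_right
      tensor_elem_scale_left tensor_elem_scale_right tensor_lift_fun_add tensor_lift_fun_scale)

lemma bisemilinear_flip3: "bisemilinear id (\<lambda>x y. tensor_lift id (\<lambda>a b.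
     tensor_lift id (\<lambda>c d. (a \<otimes>\<^sub>e c) \<otimes>\<^sub>e (b \<otimes>\<^sub>e d)) y) x)"
  by (subst bisemilinear_def, simp only: tensor_lift_add tensor_lift_scale bisemilinear_flip1
      bisemilinear_flip2 tensor_lift_fun_add tensor_lift_fun_scale id_apply simp_thms)

lemma middle_flip_elem:
  "middle_flip ((a \<otimes>\<^sub>e b) \<otimes>\<^sub>e (c \<otimes>\<^sub>e d)) = (a \<otimes>\<^sub>e c) \<otimes>\<^sub>e (b \<otimes>\<^sub>e d)"
  by (simp add: middle_flip_def tensor_lift_elem bisemilinear_flip1 bisemilinear_flip2 bisemilinear_flip3)

lemma clinear_middle_flip: "clinear middle_flip"
  by (subst clinear_iff) (simp add: middle_flip_def tensor_lift_add tensor_lift_scale bisemilinear_flip3)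

lemma bisemilinear_scalar:
  "bisemilinear id (\<lambda>z a. z *\<^sub>C a)" "bisemilinear id (\<lambda>a z. z *\<^sub>C a)"
  by (simp_all add: bisemilinear_def scaleC_add_left scaleC_add_right scaleC_scaleC
      scaleC_complex_def mult.commute)

lemma scalar_left_elem: "scalar_left (z \<otimes>\<^sub>e a) = z *\<^sub>C a"
  by (simp add: scalar_left_def tensor_lift_elem bisemilinear_scalar)

lemma scalar_right_elem: "scalar_right (a \<otimes>\<^sub>e z) = z *\<^sub>C a"
  by (simp add: scalar_right_def tensor_lift_elem bisemilinear_scalar)

section \<open>Bialgebras\<close>

definition unital_algebra :: "('a::complex_vector \<otimes> 'a \<Rightarrow> 'a) \<Rightarrow> 'a \<Rightarrow> bool" where
  "unital_algebra m u \<longleftrightarrow> clinear m \<and>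
     m \<circ> (m \<otimes>\<^sub>m id) = m \<circ> (id \<otimes>\<^sub>m m) \<circ> tensor_assoc \<and>
     (\<forall>a. m (u \<otimes>\<^sub>e a) = a \<and> m (a \<otimes>\<^sub>e u) = a)"

definition coalgebra :: "('a::complex_vector \<Rightarrow> 'a \<otimes> 'a) \<Rightarrow> ('a \<Rightarrow> complex) \<Rightarrow> bool" where
  "coalgebra D e \<longleftrightarrow> clinear D \<and> clinear e \<and>
     tensor_assoc \<circ> (D \<otimes>\<^sub>m id) \<circ> D = (id \<otimes>\<^sub>m D) \<circ> D \<and>
     scalar_left \<circ> (e \<otimes>\<^sub>m id) \<circ> D = id \<and> scalar_right \<circ> (id \<otimes>\<^sub>m e) \<circ> D = id"

definition comult2 :: "('a::complex_vector \<Rightarrow> 'a \<otimes> 'a) \<Rightarrow> 'a \<otimes> 'a \<Rightarrow> ('a \<otimes> 'a) \<otimes> ('a \<otimes> 'a)" where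
  "comult2 D = middle_flip \<circ> (D \<otimes>\<^sub>m D)"

definition counit2 :: "('a::complex_vector \<Rightarrow> complex) \<Rightarrow> 'a \<otimes> 'a \<Rightarrow> complex" where
  "counit2 e = scalar_left \<circ> (e \<otimes>\<^sub>m e)"

definition bialgebra :: "('b::complex_vector \<otimes> 'b \<Rightarrow> 'b) \<Rightarrow> 'b \<Rightarrow> ('b \<Rightarrow> 'b \<otimes> 'b) \<Rightarrow> ('b \<Rightarrow> complex) \<Rightarrow> bool" where
  "bialgebra m u D e \<longleftrightarrow> unital_algebra m u \<and> coalgebra D e \<and>
     D \<circ> m = (m \<otimes>\<^sub>m m) \<circ> comult2 D \<and> D u = u \<otimes>\<^sub>e u \<and>
     e \<circ> m = counit2 e \<and> e u = 1"

definition star_algebra :: "('b::complex_vector \<otimes> 'b \<Rightarrow> 'b) \<Rightarrow> 'b \<Rightarrow> ('b \<Rightarrow> 'b) \<Rightarrow> bool" where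
  "star_algebra m u st \<longleftrightarrow> unital_algebra m u \<and> antilinear st \<and> (\<forall>a. st (st a) = a) \<and>
     (\<forall>a b. st (m (a \<otimes>\<^sub>e b)) = m (st b \<otimes>\<^sub>e st a))"

definition star_bialgebra :: "('b::complex_vector \<otimes> 'b \<Rightarrow> 'b) \<Rightarrow> 'b \<Rightarrow> ('b \<Rightarrow> 'b \<otimes> 'b) \<Rightarrow> ('b \<Rightarrow> complex) \<Rightarrow>
    ('b \<Rightarrow> 'b) \<Rightarrow> bool" where
  "star_bialgebra m u D e st \<longleftrightarrow> bialgebra m u D e \<and> star_algebra m u st \<and>
     (\<forall>a. D (st a) = tensor_star st (D a)) \<and> (\<forall>a. e (st a) = cnj (e a))"

definition algebra_iso :: "('b::complex_vector \<otimes> 'b \<Rightarrow> 'b) \<Rightarrow> 'b \<Rightarrow> ('b \<otimes> 'b \<Rightarrow> 'b) \<Rightarrow> 'b \<Rightarrow> ('b \<Rightarrow> 'b) \<Rightarrow> bool" where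
  "algebra_iso m u m' u' f \<longleftrightarrow> unital_algebra m u \<and> unital_algebra m' u' \<and>
     clinear f \<and> bij f \<and> f u = u' \<and> f \<circ> m = m' \<circ> (f \<otimes>\<^sub>m f)"

definition star_algebra_iso :: "('b::complex_vector \<otimes> 'b \<Rightarrow> 'b) \<Rightarrow> 'b \<Rightarrow> ('b \<Rightarrow> 'b) \<Rightarrow>
    ('b \<otimes> 'b \<Rightarrow> 'b) \<Rightarrow> 'b \<Rightarrow> ('b \<Rightarrow> 'b) \<Rightarrow> ('b \<Rightarrow> 'b) \<Rightarrow> bool" where
  "star_algebra_iso m u st m' u' st' f \<longleftrightarrow> star_algebra m u st \<and> star_algebra m' u' st' \<and>
     algebra_iso m u m' u' f \<and> (\<forall>a. f (st a) = st' (f a))"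

section \<open>Convolution\<close>

text \<open>
  \<open>m\<close> is the product of the target algebra, or \<open>scalar_left\<close> or \<open>scalar_right\<close> if one of the two
  factors is scalar-valued.
\<close>

definition convolution :: "('c::complex_vector \<Rightarrow> 'c \<otimes> 'c) \<Rightarrow>
    ('x::complex_vector \<otimes> 'y::complex_vector \<Rightarrow> 'z) \<Rightarrow> ('c \<Rightarrow> 'x) \<Rightarrow> ('c \<Rightarrow> 'y) \<Rightarrow> 'c \<Rightarrow> 'z" where
  "convolution D m R S = m \<circ> (R \<otimes>\<^sub>m S) \<circ> D"

primrec conv_pow :: "('c::complex_vector \<Rightarrow> 'c \<otimes> 'c) \<Rightarrow> ('c \<Rightarrow> complex) \<Rightarrow> ('c \<Rightarrow> complex) \<Rightarrow> nat \<Rightarrow> 'c \<Rightarrow> complex" where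
  "conv_pow D e f 0 = e"
| "conv_pow D e f (Suc n) = convolution D scalar_left (conv_pow D e f n) f"

text \<open>
  For linear \<open>f\<close> on a coalgebra the series below converges at every point, since every element lies
  in a finite-dimensional subcoalgebra.
\<close>

definition conv_exp :: "('c::complex_vector \<Rightarrow> 'c \<otimes> 'c) \<Rightarrow> ('c \<Rightarrow> complex) \<Rightarrow> ('c \<Rightarrow> complex) \<Rightarrow> 'c \<Rightarrow> complex" where
  "conv_exp D e f x = suminf (\<lambda>n. conv_pow D e f n x / fact n)"

section \<open>Cochains\<close>

definition coboundary :: "('b::complex_vector \<otimes> 'b \<Rightarrow> 'b) \<Rightarrow> ('b \<Rightarrow> complex) \<Rightarrow> ('b \<Rightarrow> complex) \<Rightarrow> 'b \<otimes> 'b \<Rightarrow> complex" where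
  "coboundary m e \<psi> = tensor_lift id (\<lambda>a b. e a * \<psi> b - \<psi> (m (a \<otimes>\<^sub>e b)) + \<psi> a * e b)"

lemma coboundary_elem:
  assumes "clinear m" "clinear e" "clinear \<psi>"
  shows "coboundary m e \<psi> (a \<otimes>\<^sub>e b) = e a * \<psi> b - \<psi> (m (a \<otimes>\<^sub>e b)) + \<psi> a * e b"
proof -
  have "bisemilinear id (\<lambda>a b. e a * \<psi> b - \<psi> (m (a \<otimes>\<^sub>e b)) + \<psi> a * e b)"
    using assms
    by (simp add: clinear_iff bisemilinear_def tensor_elem_add_left tensor_elem_add_right
        tensor_elem_scale_left tensor_elem_scale_right scaleC_complex_def algebra_simps)
  then show ?thesis by (simp add: coboundary_def tensor_lift_elem)
qed

definition C1_NC :: "'b::complex_vector \<Rightarrow> ('b \<Rightarrow> 'b \<otimes> 'b) \<Rightarrow> ('b \<Rightarrow> complex) set" where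
  "C1_NC u D = {\<psi>. clinear \<psi> \<and> \<psi> u = 0 \<and>
     convolution D scalar_left \<psi> id = convolution D scalar_right id \<psi>}"

definition C1_NCH :: "'b::complex_vector \<Rightarrow> ('b \<Rightarrow> 'b \<otimes> 'b) \<Rightarrow> ('b \<Rightarrow> 'b) \<Rightarrow> ('b \<Rightarrow> complex) set" where
  "C1_NCH u D st = {\<psi> \<in> C1_NC u D. \<forall>a. \<psi> a = cnj (\<psi> (st a))}"

definition B2_NC :: "('b::complex_vector \<otimes> 'b \<Rightarrow> 'b) \<Rightarrow> 'b \<Rightarrow> ('b \<Rightarrow> 'b \<otimes> 'b) \<Rightarrow> ('b \<Rightarrow> complex) \<Rightarrow>
    ('b \<otimes> 'b \<Rightarrow> complex) set" where
  "B2_NC m u D e = coboundary m e ` C1_NC u D"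

definition B2_NCH :: "('b::complex_vector \<otimes> 'b \<Rightarrow> 'b) \<Rightarrow> 'b \<Rightarrow> ('b \<Rightarrow> 'b \<otimes> 'b) \<Rightarrow> ('b \<Rightarrow> complex) \<Rightarrow>
    ('b \<Rightarrow> 'b) \<Rightarrow> ('b \<otimes> 'b \<Rightarrow> complex) set" where
  "B2_NCH m u D e st = coboundary m e ` C1_NCH u D st"

section \<open>Additive deformations and semigroups\<close>

text \<open>
  Families indexed by \<open>t \<ge> 0\<close> are functions on all reals of which only the values at \<open>t \<ge> 0\<close> are used;
  accordingly, limits and derivatives at \<open>0\<close> are one-sided.
\<close>

definition additive_deformation :: "('b::complex_vector \<otimes> 'b \<Rightarrow> 'b) \<Rightarrow> 'b \<Rightarrow> ('b \<Rightarrow> 'b \<otimes> 'b) \<Rightarrow> ('b \<Rightarrow> complex) \<Rightarrow>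
    (real \<Rightarrow> 'b \<otimes> 'b \<Rightarrow> 'b) \<Rightarrow> bool" where
  "additive_deformation m u D e \<mu> \<longleftrightarrow>
     (\<forall>t\<ge>0. unital_algebra (\<mu> t) u) \<and> \<mu> 0 = m \<and>
     (\<forall>t\<ge>0. \<forall>s\<ge>0. D \<circ> \<mu> (t + s) = (\<mu> t \<otimes>\<^sub>m \<mu> s) \<circ> comult2 D) \<and>
     (\<forall>x. ((\<lambda>t. e (\<mu> t x)) \<longlongrightarrow> counit2 e x) (at_right 0))"

definition star_additive_deformation :: "('b::complex_vector \<otimes> 'b \<Rightarrow> 'b) \<Rightarrow> 'b \<Rightarrow> ('b \<Rightarrow> 'b \<otimes> 'b) \<Rightarrow>
    ('b \<Rightarrow> complex) \<Rightarrow> ('b \<Rightarrow> 'b) \<Rightarrow> (real \<Rightarrow> 'b \<otimes> 'b \<Rightarrow> 'b) \<Rightarrow> bool" where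
  "star_additive_deformation m u D e st \<mu> \<longleftrightarrow> star_bialgebra m u D e st \<and>
     additive_deformation m u D e \<mu> \<and> (\<forall>t\<ge>0. star_algebra (\<mu> t) u st)"

definition has_generator :: "('b::complex_vector \<Rightarrow> complex) \<Rightarrow> (real \<Rightarrow> 'b \<otimes> 'b \<Rightarrow> 'b) \<Rightarrow>
    ('b \<otimes> 'b \<Rightarrow> complex) \<Rightarrow> bool" where
  "has_generator e \<mu> L \<longleftrightarrow>
     (\<forall>x. ((\<lambda>t. e (\<mu> t x)) has_vector_derivative L x) (at 0 within {0..}))"

definition linear_semigroup :: "(real \<Rightarrow> 'b::complex_vector \<Rightarrow> 'b) \<Rightarrow> bool" where
  "linear_semigroup \<Phi> \<longleftrightarrow> (\<forall>t\<ge>0. clinear (\<Phi> t)) \<and> \<Phi> 0 = id \<and>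
     (\<forall>s\<ge>0. \<forall>t\<ge>0. \<Phi> s \<circ> \<Phi> t = \<Phi> (s + t))"

definition pointwise_continuous :: "(real \<Rightarrow> 'b::complex_vector \<Rightarrow> 'b) \<Rightarrow> bool" where
  "pointwise_continuous \<Phi> \<longleftrightarrow>
     (\<forall>b f. clinear f \<longrightarrow> ((\<lambda>t. f (\<Phi> t b)) \<longlongrightarrow> (f b :: complex)) (at_right 0))"

end

theory Submission
  imports Defs
begin

text \<open>
  For a functional \<open>f\<close> on a coalgebra let \<open>R f = id \<star> f\<close> and \<open>L f = f \<star> id\<close> be the two translations.
  Coassociativity gives \<open>f \<star> g = f \<circ> R g = g \<circ> L f\<close> and \<open>R f \<circ> R g = R (f \<star> g)\<close>, so \<open>f \<mapsto> R f\<close> is a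
  faithful representation of the convolution algebra of functionals. A linear map \<open>\<Phi>\<close> with
  \<open>(\<Phi> \<otimes> id) \<circ> D = (id \<otimes> \<Phi>) \<circ> D\<close> satisfies \<open>\<Phi> = R (e \<circ> \<Phi>) = L (e \<circ> \<Phi>)\<close> (lemma
  \<open>commuting_map_eq_translation\<close>), and a functional in \<open>C1_NC\<close> vanishes at \<open>u\<close> and has
  \<open>L \<psi> = R \<psi>\<close>, that is, it is central (\<open>R_eq_L_iff_central\<close>). Both parts are therefore statements about one-parameter groups
  \<open>E t\<close> of central functionals.

  Limits rest on local finiteness: every element is a linear combination of finitely many matrix
  coefficients \<open>c i j\<close>, on which convolution is matrix multiplication
  (\<open>combination_of_matrix_coefficients\<close>). This makes the exponential series converge absolutely and
  makes inversion of functionals continuous at the counit.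

  Part (A). With \<open>E t = exp (- t \<psi>)\<close> and \<open>\<Phi> t = R (E t)\<close>, the group law, the commutation with the
  comultiplication and bijectivity follow from \<open>E (s + t) = E s \<star> E t\<close> and centrality. Since the
  multiplication is a morphism of coalgebras, \<open>E t \<circ> m = exp (- t \<psi> \<circ> m)\<close> on the tensor square, and
  the definition of the coboundary \<open>\<partial>\<psi>\<close> reads \<open>- t \<psi> \<circ> m = t \<partial>\<psi> + P\<close>, where
  \<open>P = - t (\<psi> \<otimes> e + e \<otimes> \<psi>)\<close> is central with exponential \<open>E t \<otimes> E t\<close>. Hence
  \<open>E t \<circ> m = exp (t \<partial>\<psi>) \<star> (E t \<otimes> E t)\<close> (\<open>exp_comp_m\<close>), which in terms of translations is
  \<open>\<Phi> t \<circ> m = \<mu> t \<circ> (\<Phi> t \<otimes> \<Phi> t)\<close>. The algebra axioms and the involution are then transported from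
  \<open>m\<close> to \<open>\<mu> t\<close> along the bijection \<open>\<Phi> t\<close>.

  Part (B). Invertibility extends the semigroup to a group indexed by the reals, with functionals
  \<open>E t = e \<circ> \<Phi> t\<close>. Continuity of the group at \<open>0\<close> implies differentiability at \<open>0\<close>
  (\<open>convolution_group_differentiable\<close>), so \<open>\<psi> = - E' 0\<close> exists; it inherits centrality,
  \<open>\<psi> u = 0\<close> and hermiticity from the \<open>E t\<close>. Writing \<open>e \<circ> \<mu> t = (E t \<circ> m) \<star> (E (- t) \<otimes> E (- t))\<close>, the
  product rule for convolution gives \<open>- \<psi> \<circ> m + e \<otimes> \<psi> + \<psi> \<otimes> e\<close>, the coboundary of \<open>\<psi>\<close>, as generator.
\<close>

section \<open>Linear maps on tensor products\<close>

lemma clinear_id [simp]: "clinear id" "clinear (\<lambda>x. x)"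
  by (simp_all add: clinear_iff)

lemma clinear_comp [simp]: "clinear f \<Longrightarrow> clinear g \<Longrightarrow> clinear (g \<circ> f)"
  by (simp add: clinear_iff)

lemma clinear_addD: "clinear f \<Longrightarrow> f (x + y) = f x + f y"
  and clinear_scaleD: "clinear f \<Longrightarrow> f (c *\<^sub>C x) = c *\<^sub>C f x"
  by (simp_all add: clinear_iff)

lemma clinear_functional_scaleD:
  fixes f :: "'a::complex_vector \<Rightarrow> complex"
  shows "clinear f \<Longrightarrow> f (c *\<^sub>C x) = c * f x"
  by (simp add: clinear_scaleD scaleC_complex_def)

lemma clinear_functional_add [simp]: "clinear f \<Longrightarrow> clinear g \<Longrightarrow> clinear (\<lambda>x. f x + g x :: complex)"
  and clinear_functional_mult [simp]: "clinear f \<Longrightarrow> clinear (\<lambda>x. c * f x :: complex)"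
  and clinear_functional_uminus [simp]: "clinear f \<Longrightarrow> clinear (\<lambda>x. - f x :: complex)"
  by (simp_all add: clinear_iff scaleC_complex_def algebra_simps)

lemma clinear_zeroD: "clinear f \<Longrightarrow> f 0 = 0"
  by (metis clinear_addD add_cancel_left_left)

lemma clinear_sumD: "clinear f \<Longrightarrow> f (sum g A) = (\<Sum>i\<in>A. f (g i))"
  by (induction A rule: infinite_finite_induct) (auto simp: clinear_zeroD clinear_addD)

lemmas [simp] = clinear_tensor_map clinear_tensor_assoc clinear_middle_flip tensor_map_elem
  tensor_assoc_elem middle_flip_elem scalar_left_elem scalar_right_elem

lemma clinear_scalar [simp]: "clinear scalar_left" "clinear scalar_right"
  by (subst clinear_iff;
      simp add: scalar_left_def scalar_right_def tensor_lift_add tensor_lift_scale bisemilinear_scalar)+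

lemma clinear_tensor_elem [simp]: "clinear (\<lambda>x. x \<otimes>\<^sub>e y)" "clinear (\<lambda>x. y \<otimes>\<^sub>e x)"
  by (simp_all add: clinear_iff tensor_elem_add_left tensor_elem_add_right
      tensor_elem_scale_left tensor_elem_scale_right)

lemma clinear_eq_on_tensors:
  assumes "clinear f" "clinear g" "\<And>a b. f (a \<otimes>\<^sub>e b) = g (a \<otimes>\<^sub>e b)"
  shows "f z = g z"
  by (induction z rule: tensor_induct) (simp_all add: assms clinear_addD clinear_scaleD)

lemma clinear_tensor_ext:
  "clinear f \<Longrightarrow> clinear g \<Longrightarrow> (\<And>a b. f (a \<otimes>\<^sub>e b) = g (a \<otimes>\<^sub>e b)) \<Longrightarrow> f = g"
  by (rule ext) (rule clinear_eq_on_tensors)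

lemma clinear_eq_on_left_tensors:
  assumes f: "clinear f" and g: "clinear g"
    and eq: "\<And>a b c. f ((a \<otimes>\<^sub>e b) \<otimes>\<^sub>e c) = g ((a \<otimes>\<^sub>e b) \<otimes>\<^sub>e c)"
  shows "f z = g z"
proof (rule clinear_eq_on_tensors[OF f g])
  show "f (p \<otimes>\<^sub>e c) = g (p \<otimes>\<^sub>e c)" for p c
    using clinear_eq_on_tensors[of "f \<circ> (\<lambda>p. p \<otimes>\<^sub>e c)" "g \<circ> (\<lambda>p. p \<otimes>\<^sub>e c)" p] f g eq
    by simp
qed

lemma clinear_eq_on_double_tensors:
  assumes f: "clinear f" and g: "clinear g"
    and eq: "\<And>a b c d. f ((a \<otimes>\<^sub>e b) \<otimes>\<^sub>e (c \<otimes>\<^sub>e d)) = g ((a \<otimes>\<^sub>e b) \<otimes>\<^sub>e (c \<otimes>\<^sub>e d))"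
  shows "f z = g z"
proof (rule clinear_eq_on_left_tensors[OF f g])
  show "f ((a \<otimes>\<^sub>e b) \<otimes>\<^sub>e q) = g ((a \<otimes>\<^sub>e b) \<otimes>\<^sub>e q)" for a b q
    using clinear_eq_on_tensors[of "f \<circ> (\<lambda>q. (a \<otimes>\<^sub>e b) \<otimes>\<^sub>e q)" "g \<circ> (\<lambda>q. (a \<otimes>\<^sub>e b) \<otimes>\<^sub>e q)" q] f g eq
    by simp
qed

lemma tensor_map_id [simp]: "id \<otimes>\<^sub>m id = id"
  by (rule ext, rule clinear_eq_on_tensors) simp_all

lemma tensor_map_comp:
  assumes "clinear f" "clinear g" "clinear h" "clinear k"
  shows "(f \<otimes>\<^sub>m g) \<circ> (h \<otimes>\<^sub>m k) = (f \<circ> h) \<otimes>\<^sub>m (g \<circ> k)"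
  using clinear_eq_on_tensors[of "(f \<otimes>\<^sub>m g) \<circ> (h \<otimes>\<^sub>m k)" "(f \<circ> h) \<otimes>\<^sub>m (g \<circ> k)"] assms
  by (auto simp: fun_eq_iff)

lemma tensor_map_map:
  assumes "clinear f" "clinear g" "clinear h" "clinear k"
  shows "(f \<otimes>\<^sub>m g) ((h \<otimes>\<^sub>m k) z) = ((f \<circ> h) \<otimes>\<^sub>m (g \<circ> k)) z"
  using tensor_map_comp[OF assms] by (metis comp_apply)

lemma middle_flip_tensor_map:
  assumes "clinear f" "clinear g" "clinear h" "clinear k"
  shows "middle_flip (((f \<otimes>\<^sub>m g) \<otimes>\<^sub>m (h \<otimes>\<^sub>m k)) z) = ((f \<otimes>\<^sub>m h) \<otimes>\<^sub>m (g \<otimes>\<^sub>m k)) (middle_flip z)"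
  using clinear_eq_on_double_tensors[of "middle_flip \<circ> ((f \<otimes>\<^sub>m g) \<otimes>\<^sub>m (h \<otimes>\<^sub>m k))"
      "((f \<otimes>\<^sub>m h) \<otimes>\<^sub>m (g \<otimes>\<^sub>m k)) \<circ> middle_flip" z] assms
  by simp

text \<open>
  The functional \<open>a \<otimes> b \<mapsto> f a * g b\<close>. The counit of the tensor square of a coalgebra is of this
  form, and the convolution of functionals is such a functional after the comultiplication.
\<close>

definition functional_tensor ::
    "('a::complex_vector \<Rightarrow> complex) \<Rightarrow> ('b::complex_vector \<Rightarrow> complex) \<Rightarrow> 'a \<otimes> 'b \<Rightarrow> complex" where
  "functional_tensor f g = scalar_left \<circ> (f \<otimes>\<^sub>m g)"

lemma clinear_functional_tensor [simp]:
  "clinear f \<Longrightarrow> clinear g \<Longrightarrow> clinear (functional_tensor f g)"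
  by (simp add: functional_tensor_def)

lemma functional_tensor_elem [simp]:
  "clinear f \<Longrightarrow> clinear g \<Longrightarrow> functional_tensor f g (a \<otimes>\<^sub>e b) = f a * g b"
  by (simp add: functional_tensor_def scaleC_complex_def)

lemma functional_tensor_map:
  assumes "clinear f" "clinear g" "clinear h" "clinear k"
  shows "functional_tensor f g ((h \<otimes>\<^sub>m k) z) = functional_tensor (f \<circ> h) (g \<circ> k) z"
  by (simp add: functional_tensor_def tensor_map_map assms)

lemma functional_scalar_right:
  assumes "clinear f" "clinear g"
  shows "f (scalar_right ((id \<otimes>\<^sub>m g) z)) = functional_tensor f g z"
  using clinear_eq_on_tensors[of "f \<circ> scalar_right \<circ> (id \<otimes>\<^sub>m g)" "functional_tensor f g" z] assms
  by (simp add: clinear_functional_scaleD)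

lemma functional_scalar_left:
  assumes "clinear f" "clinear g"
  shows "g (scalar_left ((f \<otimes>\<^sub>m id) z)) = functional_tensor f g z"
  using clinear_eq_on_tensors[of "g \<circ> scalar_left \<circ> (f \<otimes>\<^sub>m id)" "functional_tensor f g" z] assms
  by (simp add: clinear_functional_scaleD)

lemma functional_tensor_antilinear:
  assumes "antilinear st" "clinear f" "clinear g" "\<And>a. f (st a) = cnj (f a)" "\<And>a. g (st a) = cnj (g a)"
  shows "functional_tensor f g (tensor_star st z) = cnj (functional_tensor f g z)"
proof (induction z rule: tensor_induct)
  case (elem a b)
  then show ?case by (simp add: assms tensor_star_elem)
next
  case (add x y)
  then show ?case
    using antilinear_tensor_star[OF assms(1)] by (simp add: assms antilinear_def clinear_addD)
next
  case (scale c x)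
  then show ?case
    using antilinear_tensor_star[OF assms(1)]
    by (simp add: assms antilinear_def clinear_functional_scaleD)
qed

section \<open>Functionals separate points\<close>

text \<open>
  Extend a basis of \<open>S\<close> together with \<open>w\<close> to a basis of the whole space. This replaces topological
  arguments: to show that a subspace is everything it suffices to look at functionals vanishing on it.
\<close>

lemma functional_vanishing_on_subspace:
  fixes S :: "'a::complex_vector set"
  assumes S: "cvec.subspace S" and w: "w \<notin> S"
  obtains \<phi> :: "'a \<Rightarrow> complex" where "clinear \<phi>" "\<And>x. x \<in> S \<Longrightarrow> \<phi> x = 0" "\<phi> w = 1"
proof -
  interpret vector_space_pair "scaleC :: complex \<Rightarrow> 'a \<Rightarrow> 'a" "scaleC :: complex \<Rightarrow> complex \<Rightarrow> complex"
    by unfold_locales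
  obtain B where B: "B \<subseteq> S" "cvec.independent B" "S \<subseteq> cvec.span B"
    using cvec.basis_exists by metis
  have "w \<notin> cvec.span B"
    using w B(1) S cvec.span_minimal by blast
  then have ind: "cvec.independent (insert w B)"
    using B(2) by (rule cvec.independent_insertI)
  define \<phi> where "\<phi> = construct (insert w B) (\<lambda>x. if x = w then 1 else 0 :: complex)"
  have lin: "clinear \<phi>"
    unfolding \<phi>_def by (rule linear_construct[OF ind])
  have "\<phi> x = 0" if "x \<in> S" for x
  proof (rule linear_eq_on[OF lin, of "\<lambda>_. 0" x B])
    show "clinear (\<lambda>_. 0 :: complex)" by (simp add: clinear_iff)
    show "x \<in> cvec.span B" using that B by auto
    show "\<phi> b = 0" if "b \<in> B" for b
      using that w B(1) by (auto simp: \<phi>_def construct_basis[OF ind])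
  qed
  moreover have "\<phi> w = 1" by (simp add: \<phi>_def construct_basis[OF ind])
  ultimately show ?thesis using that lin by blast
qed

lemma functionals_separate_points:
  fixes x y :: "'a::complex_vector"
  assumes "\<And>\<phi> :: 'a \<Rightarrow> complex. clinear \<phi> \<Longrightarrow> \<phi> x = \<phi> y"
  shows "x = y"
proof (rule ccontr)
  assume "x \<noteq> y"
  then obtain \<phi> :: "'a \<Rightarrow> complex" where \<phi>: "clinear \<phi>" "\<phi> (x - y) = 1"
    using functional_vanishing_on_subspace[of "{0}" "x - y"] by (auto simp: cvec.subspace_def)
  then show False using assms[OF \<phi>(1)] clinear_addD[OF \<phi>(1), of "x - y" y] by simp
qed

lemma dual_basis:
  fixes B :: "'a::complex_vector set"
  assumes B: "cvec.independent B" "finite B"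
  obtains \<phi> :: "'a \<Rightarrow> 'a \<Rightarrow> complex" where "\<And>b. clinear (\<phi> b)"
    "\<And>b c. b \<in> B \<Longrightarrow> c \<in> B \<Longrightarrow> \<phi> b c = (if c = b then 1 else 0)"
    "\<And>x. x \<in> cvec.span B \<Longrightarrow> x = (\<Sum>b\<in>B. \<phi> b x *\<^sub>C b)"
proof -
  interpret vector_space_pair "scaleC :: complex \<Rightarrow> 'a \<Rightarrow> 'a" "scaleC :: complex \<Rightarrow> complex \<Rightarrow> complex"
    by unfold_locales
  define \<phi> where "\<phi> = (\<lambda>b. construct B (\<lambda>x. if x = b then 1 else 0 :: complex))"
  have lin: "clinear (\<phi> b)" for b
    unfolding \<phi>_def by (rule linear_construct[OF B(1)])
  have val: "\<phi> b c = (if c = b then 1 else 0)" if "c \<in> B" for b c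
    using that by (simp add: \<phi>_def construct_basis[OF B(1)])
  have "x = (\<Sum>b\<in>B. \<phi> b x *\<^sub>C b)" if x_in: "x \<in> cvec.span B" for x
  proof -
    obtain r where x: "x = (\<Sum>b\<in>B. r b *\<^sub>C b)"
      using x_in by (auto simp: cvec.span_finite[OF B(2)])
    have "\<phi> b x = r b" if "b \<in> B" for b
    proof -
      have "\<phi> b x = (\<Sum>c\<in>B. if c = b then r c else 0)"
        unfolding x clinear_sumD[OF lin]
        by (intro sum.cong) (auto simp: clinear_functional_scaleD[OF lin] val)
      then show ?thesis using that B(2) by simp
    qed
    then show ?thesis by (simp add: x cong: sum.cong)
  qed
  then show ?thesis using that lin val by blast
qed

section \<open>Translations and convolution on a coalgebra\<close>

text \<open>
  Identities between maps into tensor products are checked on elementary tensors in place of Sweedler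
  sums: both sides are first written as linear functions of \<open>D x\<close> or of \<open>(D \<otimes> id) (D x)\<close>.
\<close>

locale coalg =
  fixes D :: "'c::complex_vector \<Rightarrow> 'c \<otimes> 'c" and e :: "'c \<Rightarrow> complex"
  assumes coalgebra: "coalgebra D e"
begin

abbreviation conv :: "('c \<Rightarrow> complex) \<Rightarrow> ('c \<Rightarrow> complex) \<Rightarrow> 'c \<Rightarrow> complex"  (infixl "\<star>" 70) where "f \<star> g \<equiv> convolution D scalar_left f g"

abbreviation R :: "('c \<Rightarrow> complex) \<Rightarrow> 'c \<Rightarrow> 'c" where "R f \<equiv> convolution D scalar_right id f"

abbreviation L :: "('c \<Rightarrow> complex) \<Rightarrow> 'c \<Rightarrow> 'c" where "L f \<equiv> convolution D scalar_left f id"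

lemma clinear_D [simp]: "clinear D" and clinear_e [simp]: "clinear e"
  using coalgebra by (simp_all add: coalgebra_def)

lemma coassoc: "tensor_assoc ((D \<otimes>\<^sub>m id) (D x)) = (id \<otimes>\<^sub>m D) (D x)"
  using coalgebra by (simp add: coalgebra_def fun_eq_iff)

lemma R_counit [simp]: "R e = id" and L_counit [simp]: "L e = id"
  using coalgebra by (simp_all add: coalgebra_def convolution_def)

lemma clinear_R [simp]: "clinear f \<Longrightarrow> clinear (R f)"
  and clinear_L [simp]: "clinear f \<Longrightarrow> clinear (L f)"
  and clinear_conv [simp]: "clinear f \<Longrightarrow> clinear g \<Longrightarrow> clinear (f \<star> g)"
  by (simp_all add: convolution_def)

lemma conv_eq_functional_tensor: "(f \<star> g) x = functional_tensor f g (D x)"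
  by (simp add: convolution_def functional_tensor_def)

text \<open>
  These two formulas turn computations with convolution into composition with the translations, which
  absorbs most uses of coassociativity.
\<close>

lemma conv_eq_R: "clinear f \<Longrightarrow> clinear g \<Longrightarrow> (f \<star> g) x = f (R g x)"
  and conv_eq_L: "clinear f \<Longrightarrow> clinear g \<Longrightarrow> (f \<star> g) x = g (L f x)"
  unfolding conv_eq_functional_tensor
  by (simp_all add: convolution_def functional_scalar_right functional_scalar_left)

lemma functional_of_L: "clinear f \<Longrightarrow> clinear g \<Longrightarrow> g (L f x) = f (R g x)"
  using conv_eq_R conv_eq_L by metis

lemma conv_counit [simp]: "clinear f \<Longrightarrow> f \<star> e = f" "clinear f \<Longrightarrow> e \<star> f = f"
  by (simp_all add: fun_eq_iff conv_eq_R[of f] conv_eq_L[of e])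

text \<open>
  The next three lemmas are coassociativity with a functional applied to the third, second and first
  of the legs \<open>x\<^sub>1 \<otimes> x\<^sub>2 \<otimes> x\<^sub>3\<close>, respectively.
\<close>

lemma D_R:
  assumes f: "clinear f"
  shows "D (R f x) = (id \<otimes>\<^sub>m R f) (D x)"
proof -
  let ?S = "id \<otimes>\<^sub>m (scalar_right \<circ> (id \<otimes>\<^sub>m f)) :: 'c \<otimes> 'c \<otimes> 'c \<Rightarrow> 'c \<otimes> 'c"
  have slice: "?S (tensor_assoc (p \<otimes>\<^sub>e c)) = f c *\<^sub>C p" for p :: "'c \<otimes> 'c" and c
    using clinear_eq_on_tensors[of "?S \<circ> tensor_assoc \<circ> (\<lambda>p. p \<otimes>\<^sub>e c)" "\<lambda>p. f c *\<^sub>C p" p] f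
    by (simp add: tensor_elem_scale_right clinear_iff[of "\<lambda>p. f c *\<^sub>C p"] scaleC_add_right
        scaleC_scaleC mult.commute)
  have "D (scalar_right ((id \<otimes>\<^sub>m f) z)) = ?S (tensor_assoc ((D \<otimes>\<^sub>m id) z))" for z
    using clinear_eq_on_tensors[of "D \<circ> scalar_right \<circ> (id \<otimes>\<^sub>m f)" "?S \<circ> tensor_assoc \<circ> (D \<otimes>\<^sub>m id)" z] f
    by (simp add: slice clinear_scaleD)
  then show ?thesis
    using f by (simp add: convolution_def coassoc tensor_map_map comp_assoc)
qed

lemma R_tensor_L:
  assumes f: "clinear f"
  shows "(R f \<otimes>\<^sub>m id) (D x) = (id \<otimes>\<^sub>m L f) (D x)"
proof -
  let ?r = "scalar_right \<circ> (id \<otimes>\<^sub>m f)" and ?l = "scalar_left \<circ> (f \<otimes>\<^sub>m id)"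
  have "(?r \<otimes>\<^sub>m id) w = (id \<otimes>\<^sub>m ?l) (tensor_assoc w)" for w :: "('c \<otimes> 'c) \<otimes> 'c"
    using clinear_eq_on_left_tensors[of "?r \<otimes>\<^sub>m id" "(id \<otimes>\<^sub>m ?l) \<circ> tensor_assoc" w] f
    by (simp add: tensor_elem_scale_left tensor_elem_scale_right)
  from this[of "(D \<otimes>\<^sub>m id) (D x)"] show ?thesis
    using f by (simp add: convolution_def coassoc tensor_map_map comp_assoc)
qed

lemma D_L:
  assumes f: "clinear f"
  shows "D (L f x) = (L f \<otimes>\<^sub>m id) (D x)"
proof -
  let ?l = "scalar_left \<circ> (f \<otimes>\<^sub>m id)"
  have slice: "(?l \<otimes>\<^sub>m id) w = scalar_left ((f \<otimes>\<^sub>m id) (tensor_assoc w))" for w :: "('c \<otimes> 'c) \<otimes> 'c"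
    using clinear_eq_on_left_tensors[of "?l \<otimes>\<^sub>m id" "scalar_left \<circ> (f \<otimes>\<^sub>m id) \<circ> tensor_assoc" w] f
    by (simp add: tensor_elem_scale_left tensor_elem_scale_right)
  have "D (scalar_left ((f \<otimes>\<^sub>m id) z)) = scalar_left ((f \<otimes>\<^sub>m D) z)" for z
    using clinear_eq_on_tensors[of "D \<circ> scalar_left \<circ> (f \<otimes>\<^sub>m id)" "scalar_left \<circ> (f \<otimes>\<^sub>m D)" z] f
    by (simp add: clinear_scaleD)
  then show ?thesis
    using f slice[of "(D \<otimes>\<^sub>m id) (D x)"]
    by (simp add: convolution_def coassoc tensor_map_map comp_assoc)
qed

lemma R_R:
  assumes "clinear f" "clinear g"
  shows "R f (R g x) = R (f \<star> g) x"
proof -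
  have "f \<circ> R g = f \<star> g" using assms by (simp add: fun_eq_iff conv_eq_R)
  moreover have "R f (R g x) = scalar_right ((id \<otimes>\<^sub>m f) (D (R g x)))"
    by (simp add: convolution_def)
  moreover have "R (f \<star> g) x = scalar_right ((id \<otimes>\<^sub>m (f \<star> g)) (D x))"
    unfolding convolution_def[of D scalar_right] by simp
  ultimately show ?thesis using assms by (simp add: D_R tensor_map_map)
qed

lemma conv_assoc:
  assumes "clinear f" "clinear g" "clinear h"
  shows "(f \<star> g) \<star> h = f \<star> (g \<star> h)"
proof
  fix x
  have "((f \<star> g) \<star> h) x = f (R g (R h x))"
    using assms by (simp add: conv_eq_R)
  also have "\<dots> = (f \<star> (g \<star> h)) x"
    using assms by (simp add: conv_eq_R[of f] R_R)
  finally show "((f \<star> g) \<star> h) x = (f \<star> (g \<star> h)) x" .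
qed

lemma R_eq_L_iff_central:
  assumes "clinear f"
  shows "L f = R f \<longleftrightarrow> (\<forall>g. clinear g \<longrightarrow> f \<star> g = g \<star> f)"
proof
  assume "L f = R f"
  then show "\<forall>g. clinear g \<longrightarrow> f \<star> g = g \<star> f"
    using assms by (simp add: fun_eq_iff conv_eq_L[of f] conv_eq_R[of _ f])
next
  assume *: "\<forall>g. clinear g \<longrightarrow> f \<star> g = g \<star> f"
  show "L f = R f"
  proof (rule ext, rule functionals_separate_points)
    fix x and \<phi> :: "'c \<Rightarrow> complex" assume "clinear \<phi>"
    then show "\<phi> (L f x) = \<phi> (R f x)"
      using * assms by (metis conv_eq_L conv_eq_R)
  qed
qed

text \<open>
  A linear map that can be moved from one leg of the comultiplication to the other is determined by
  its composition with the counit; applying the counit to either leg recovers it.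
\<close>

lemma commuting_map_eq_translation:
  assumes \<Phi>: "clinear \<Phi>" and comm: "(\<Phi> \<otimes>\<^sub>m id) \<circ> D = (id \<otimes>\<^sub>m \<Phi>) \<circ> D"
  shows "R (e \<circ> \<Phi>) = \<Phi>" "L (e \<circ> \<Phi>) = \<Phi>"
proof -
  have comm: "(\<Phi> \<otimes>\<^sub>m id) (D x) = (id \<otimes>\<^sub>m \<Phi>) (D x)" for x
    using comm by (simp add: fun_eq_iff)
  have "scalar_right ((\<Phi> \<otimes>\<^sub>m e) z) = \<Phi> (scalar_right ((id \<otimes>\<^sub>m e) z))"
    "scalar_left ((e \<otimes>\<^sub>m \<Phi>) z) = \<Phi> (scalar_left ((e \<otimes>\<^sub>m id) z))" for z
    using clinear_eq_on_tensors[of "scalar_right \<circ> (\<Phi> \<otimes>\<^sub>m e)" "\<Phi> \<circ> scalar_right \<circ> (id \<otimes>\<^sub>m e)" z]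
      clinear_eq_on_tensors[of "scalar_left \<circ> (e \<otimes>\<^sub>m \<Phi>)" "\<Phi> \<circ> scalar_left \<circ> (e \<otimes>\<^sub>m id)" z] \<Phi>
    by (simp_all add: clinear_scaleD)
  moreover have "(id \<otimes>\<^sub>m (e \<circ> \<Phi>)) (D x) = (\<Phi> \<otimes>\<^sub>m e) (D x)"
    "((e \<circ> \<Phi>) \<otimes>\<^sub>m id) (D x) = (e \<otimes>\<^sub>m \<Phi>) (D x)" for x
    using \<Phi> arg_cong[OF comm[of x], of "id \<otimes>\<^sub>m e"] arg_cong[OF comm[of x], of "e \<otimes>\<^sub>m id"]
    by (simp_all add: tensor_map_map)
  moreover have "scalar_right ((id \<otimes>\<^sub>m e) (D x)) = x" "scalar_left ((e \<otimes>\<^sub>m id) (D x)) = x" for x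
    using coalgebra by (simp_all add: coalgebra_def fun_eq_iff)
  ultimately show "R (e \<circ> \<Phi>) = \<Phi>" "L (e \<circ> \<Phi>) = \<Phi>"
    by (simp_all add: fun_eq_iff convolution_def)
qed

lemma clinear_conv_pow [simp]:
  assumes f: "clinear f"
  shows "clinear (conv_pow D e f n)"
  by (induction n) (simp_all add: f)

subsection \<open>The tensor square\<close>

abbreviation D2 where "D2 \<equiv> comult2 D"
abbreviation e2 where "e2 \<equiv> counit2 e"

lemma counit2_eq: "e2 = functional_tensor e e"
  by (simp add: counit2_def functional_tensor_def)

lemma clinear_D2 [simp]: "clinear D2"
  by (simp add: comult2_def)

text \<open>
  Translation on the tensor square by a product functional acts on each factor separately; this makes
  the counit axioms and the centrality of \<open>f \<otimes> e\<close> immediate.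
\<close>

lemma convolution_tensor_maps:
  assumes "clinear f" "clinear g"
  shows "scalar_right ((id \<otimes>\<^sub>m functional_tensor f g) (D2 z)) = (R f \<otimes>\<^sub>m R g) z"
    and "scalar_left ((functional_tensor f g \<otimes>\<^sub>m id) (D2 z)) = (L f \<otimes>\<^sub>m L g) z"
proof -
  let ?r = "\<lambda>f. scalar_right \<circ> (id \<otimes>\<^sub>m f)" and ?l = "\<lambda>f. scalar_left \<circ> (f \<otimes>\<^sub>m id)"
  have "?r (functional_tensor f g) (middle_flip w) = (?r f \<otimes>\<^sub>m ?r g) w"
    "?l (functional_tensor f g) (middle_flip w) = (?l f \<otimes>\<^sub>m ?l g) w"
    for w :: "('c \<otimes> 'c) \<otimes> ('c \<otimes> 'c)"
    using clinear_eq_on_double_tensors[of "?r (functional_tensor f g) \<circ> middle_flip" "?r f \<otimes>\<^sub>m ?r g" w]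
      clinear_eq_on_double_tensors[of "?l (functional_tensor f g) \<circ> middle_flip" "?l f \<otimes>\<^sub>m ?l g" w] assms
    by (simp_all add: tensor_elem_scale_right tensor_elem_scale_left scaleC_scaleC mult.commute)
  from this[of "(D \<otimes>\<^sub>m D) z"]
  show "scalar_right ((id \<otimes>\<^sub>m functional_tensor f g) (D2 z)) = (R f \<otimes>\<^sub>m R g) z"
    "scalar_left ((functional_tensor f g \<otimes>\<^sub>m id) (D2 z)) = (L f \<otimes>\<^sub>m L g) z"
    using assms by (simp_all add: comult2_def convolution_def tensor_map_map comp_assoc)
qed

text \<open>
  Both sides are images of \<open>D a \<otimes> D b\<close> under the shuffle \<open>\<Theta>\<close>, which sends
  \<open>(a\<^sub>1 \<otimes> a\<^sub>2 \<otimes> a\<^sub>3) \<otimes> (b\<^sub>1 \<otimes> b\<^sub>2 \<otimes> b\<^sub>3)\<close> to \<open>(a\<^sub>1 \<otimes> b\<^sub>1) \<otimes> (a\<^sub>2 \<otimes> b\<^sub>2) \<otimes> (a\<^sub>3 \<otimes> b\<^sub>3)\<close>, after coassociativity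
  has been applied in each factor.
\<close>

lemma coassoc2: "tensor_assoc ((D2 \<otimes>\<^sub>m id) (D2 z)) = (id \<otimes>\<^sub>m D2) (D2 z)"
proof -
  define \<Theta> :: "('c \<otimes> 'c \<otimes> 'c) \<otimes> ('c \<otimes> 'c \<otimes> 'c) \<Rightarrow> ('c \<otimes> 'c) \<otimes> ('c \<otimes> 'c) \<otimes> ('c \<otimes> 'c)"
    where "\<Theta> = (id \<otimes>\<^sub>m middle_flip) \<circ> middle_flip"
  have \<Theta>: "clinear \<Theta>" by (simp add: \<Theta>_def)
  have shuffle: "tensor_assoc (middle_flip w \<otimes>\<^sub>e (y \<otimes>\<^sub>e y'))
      = (\<Theta> \<circ> ((tensor_assoc \<circ> (\<lambda>p. p \<otimes>\<^sub>e y)) \<otimes>\<^sub>m (tensor_assoc \<circ> (\<lambda>p. p \<otimes>\<^sub>e y')))) w"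
    for y y' :: 'c and w :: "('c \<otimes> 'c) \<otimes> ('c \<otimes> 'c)"
    using clinear_eq_on_double_tensors[of "tensor_assoc \<circ> (\<lambda>p. p \<otimes>\<^sub>e (y \<otimes>\<^sub>e y')) \<circ> middle_flip"
        "\<Theta> \<circ> ((tensor_assoc \<circ> (\<lambda>p. p \<otimes>\<^sub>e y)) \<otimes>\<^sub>m (tensor_assoc \<circ> (\<lambda>p. p \<otimes>\<^sub>e y')))" w] \<Theta>
    by (simp add: \<Theta>_def)
  have left: "tensor_assoc ((D2 \<otimes>\<^sub>m id) (middle_flip w))
      = \<Theta> (((tensor_assoc \<circ> (D \<otimes>\<^sub>m id)) \<otimes>\<^sub>m (tensor_assoc \<circ> (D \<otimes>\<^sub>m id))) w)" for w
    using clinear_eq_on_double_tensors[of "tensor_assoc \<circ> (D2 \<otimes>\<^sub>m id) \<circ> middle_flip"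
        "\<Theta> \<circ> ((tensor_assoc \<circ> (D \<otimes>\<^sub>m id)) \<otimes>\<^sub>m (tensor_assoc \<circ> (D \<otimes>\<^sub>m id)))" w] \<Theta>
    by (simp add: comult2_def[of D] shuffle)
  have right: "(id \<otimes>\<^sub>m D2) (middle_flip w) = \<Theta> (((id \<otimes>\<^sub>m D) \<otimes>\<^sub>m (id \<otimes>\<^sub>m D)) w)" for w
    using clinear_eq_on_double_tensors[of "(id \<otimes>\<^sub>m D2) \<circ> middle_flip"
        "\<Theta> \<circ> ((id \<otimes>\<^sub>m D) \<otimes>\<^sub>m (id \<otimes>\<^sub>m D))" w] \<Theta>
    by (simp add: comult2_def[of D] \<Theta>_def)
  have "(tensor_assoc \<circ> (D \<otimes>\<^sub>m id)) \<circ> D = (id \<otimes>\<^sub>m D) \<circ> D"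
    by (simp add: fun_eq_iff coassoc)
  then show ?thesis
    using left[of "(D \<otimes>\<^sub>m D) z"] right[of "(D \<otimes>\<^sub>m D) z"]
    by (simp add: comult2_def[of D, THEN fun_cong] tensor_map_map)
qed

lemma coalgebra_tensor_square: "coalgebra D2 e2"
  unfolding coalgebra_def counit2_eq
  by (auto simp: fun_eq_iff coassoc2 convolution_tensor_maps)

end

section \<open>Matrix coefficients\<close>

context coalg
begin

lemma finite_span_slices:
  fixes z :: "'a::complex_vector \<otimes> 'b::complex_vector"
  shows "\<exists>S. finite S \<and> (\<forall>g. clinear g \<longrightarrow> scalar_right ((id \<otimes>\<^sub>m g) z) \<in> cvec.span S)"
proof (induction z rule: tensor_induct)
  case (elem a b)
  then show ?case
    by (intro exI[of _ "{a}"]) (simp add: cvec.span_base cvec.span_scale)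
next
  case (add y z)
  then obtain S T where "finite S" "\<forall>g. clinear g \<longrightarrow> scalar_right ((id \<otimes>\<^sub>m g) y) \<in> cvec.span S"
    "finite T" "\<forall>g. clinear g \<longrightarrow> scalar_right ((id \<otimes>\<^sub>m g) z) \<in> cvec.span T"
    by blast
  moreover have "cvec.span S \<subseteq> cvec.span (S \<union> T)" "cvec.span T \<subseteq> cvec.span (S \<union> T)"
    by (simp_all add: cvec.span_mono)
  moreover have "scalar_right ((id \<otimes>\<^sub>m g) (y + z))
      = scalar_right ((id \<otimes>\<^sub>m g) y) + scalar_right ((id \<otimes>\<^sub>m g) z)" if "clinear g" for g :: "'b \<Rightarrow> complex"
    using clinear_addD[of "scalar_right \<circ> (id \<otimes>\<^sub>m g)" y z] that by simp
  ultimately show ?case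
    by (intro exI[of _ "S \<union> T"]) (metis (no_types, lifting) cvec.span_add finite_UnI subsetD)
next
  case (scale c z)
  moreover have "scalar_right ((id \<otimes>\<^sub>m g) (c *\<^sub>C z)) = c *\<^sub>C scalar_right ((id \<otimes>\<^sub>m g) z)"
    if "clinear g" for g :: "'b \<Rightarrow> complex"
    using clinear_scaleD[of "scalar_right \<circ> (id \<otimes>\<^sub>m g)" c z] that by simp
  ultimately show ?case
    by (metis (no_types, lifting) cvec.span_scale)
qed

text \<open>
  The relation \<open>D (c i j) = (\<Sum>k. c i k \<otimes> c k j)\<close> is expressed through its values under functionals,
  the only form in which it is applied.
\<close>

definition comatrix :: "'c set \<Rightarrow> ('c \<Rightarrow> 'c \<Rightarrow> 'c) \<Rightarrow> bool" where
  "comatrix I c \<longleftrightarrow> finite I \<and> (\<forall>i\<in>I. \<forall>j\<in>I. e (c i j) = (if i = j then 1 else 0)) \<and>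
     (\<forall>f g. clinear f \<longrightarrow> clinear g \<longrightarrow>
        (\<forall>i\<in>I. \<forall>j\<in>I. (f \<star> g) (c i j) = (\<Sum>k\<in>I. f (c i k) * g (c k j))))"

lemma comatrixD:
  assumes "comatrix I c"
  shows "finite I" "i \<in> I \<Longrightarrow> j \<in> I \<Longrightarrow> e (c i j) = (if i = j then 1 else 0)"
    "clinear f \<Longrightarrow> clinear g \<Longrightarrow> i \<in> I \<Longrightarrow> j \<in> I \<Longrightarrow>
       (f \<star> g) (c i j) = (\<Sum>k\<in>I. f (c i k) * g (c k j))"
  using assms unfolding comatrix_def by blast+

text \<open>
  The translates \<open>R g x\<close> lie in the span of the finitely many left legs of \<open>D x\<close>. They contain \<open>x\<close> and
  are mapped among themselves by translations, so in a basis \<open>I\<close> of their span every \<open>R f\<close> is a matrix. With the dual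
  basis \<open>\<phi>\<close> its entries are \<open>\<phi> i (R f j) = f (L (\<phi> i) j)\<close>, the values of \<open>f\<close> at fixed elements.
\<close>

lemma combination_of_matrix_coefficients:
  "\<exists>I c \<gamma>. comatrix I c \<and> (\<forall>f :: 'c \<Rightarrow> complex. clinear f \<longrightarrow> f x = (\<Sum>i\<in>I. \<Sum>j\<in>I. \<gamma> i j * f (c i j)))"
proof -
  define W where "W = {R g x | g. clinear g}"
  have W_R: "R f y \<in> W" if y: "y \<in> W" and f: "clinear f" for f y
  proof -
    obtain g where "y = R g x" "clinear g" using y W_def by blast
    then show ?thesis
      unfolding W_def using f by (auto simp: R_R intro!: exI[of _ "f \<star> g"])
  qed
  have "R e x \<in> W" unfolding W_def mem_Collect_eq by (intro exI[of _ e] conjI refl clinear_e)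
  then have x: "x \<in> W" by simp
  obtain I where I: "I \<subseteq> W" "cvec.independent I" "W \<subseteq> cvec.span I"
    using cvec.basis_exists by metis
  have "finite I"
  proof -
    obtain S where "finite S" "\<forall>g. clinear g \<longrightarrow> scalar_right ((id \<otimes>\<^sub>m g) (D x)) \<in> cvec.span S"
      using finite_span_slices by blast
    then have "finite S" "I \<subseteq> cvec.span S"
      using I(1) by (auto simp: W_def convolution_def)
    then show ?thesis using I(2) cvec.independent_span_bound by blast
  qed
  then obtain \<phi> :: "'c \<Rightarrow> 'c \<Rightarrow> complex" where \<phi>: "\<And>b. clinear (\<phi> b)"
    "\<And>b c. b \<in> I \<Longrightarrow> c \<in> I \<Longrightarrow> \<phi> b c = (if c = b then 1 else 0)"
    "\<And>y. y \<in> cvec.span I \<Longrightarrow> y = (\<Sum>b\<in>I. \<phi> b y *\<^sub>C b)"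
    using dual_basis[OF I(2)] by blast
  define c where "c = (\<lambda>i j. L (\<phi> i) j)"
  have c: "f (c i j) = \<phi> i (R f j)" if "clinear f" for f i j
    using conv_eq_L[OF \<phi>(1) that] conv_eq_R[OF \<phi>(1) that] by (simp add: c_def)
  have W_expand: "y = (\<Sum>b\<in>I. \<phi> b y *\<^sub>C b)" if "y \<in> W" for y
    using \<phi>(3) I(3) that by blast
  have "comatrix I c"
    unfolding comatrix_def
  proof (intro conjI ballI allI impI)
    show "finite I" by fact
    show "e (c i j) = (if i = j then 1 else 0)" if "i \<in> I" "j \<in> I" for i j
      using that by (simp add: c \<phi>(2))
    show "(f \<star> g) (c i j) = (\<Sum>k\<in>I. f (c i k) * g (c k j))"
      if f: "clinear f" and g: "clinear g" and ij: "i \<in> I" "j \<in> I" for f g i j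
    proof -
      have "(f \<star> g) (c i j) = \<phi> i (R f (R g j))"
        unfolding c[OF clinear_conv[OF f g]] R_R[OF f g] ..
      also have "R g j = (\<Sum>k\<in>I. g (c k j) *\<^sub>C k)"
        using W_expand[OF W_R[of j g]] ij I(1) g by (auto simp: c)
      finally show ?thesis
        unfolding clinear_sumD[OF clinear_R[OF f]] clinear_scaleD[OF clinear_R[OF f]]
          clinear_sumD[OF \<phi>(1)] clinear_functional_scaleD[OF \<phi>(1)] c[OF f, symmetric]
        by (simp add: mult.commute)
    qed
  qed
  moreover have "f x = (\<Sum>i\<in>I. \<Sum>j\<in>I. e i * \<phi> j x * f (c i j))" if f: "clinear f" for f
  proof -
    have "f x = e (R f x)" using conv_eq_R[OF clinear_e f] f by simp
    also have "R f x = (\<Sum>j\<in>I. \<phi> j x *\<^sub>C R f j)"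
      by (subst W_expand[OF x])
        (simp only: clinear_sumD[OF clinear_R[OF f]] clinear_scaleD[OF clinear_R[OF f]])
    also have "\<dots> = (\<Sum>j\<in>I. \<phi> j x *\<^sub>C (\<Sum>i\<in>I. f (c i j) *\<^sub>C i))"
      using W_expand[OF W_R] I(1) f by (intro sum.cong) (auto simp: c)
    finally have "f x = (\<Sum>j\<in>I. \<Sum>i\<in>I. e i * \<phi> j x * f (c i j))"
      by (simp add: clinear_sumD[OF clinear_e] clinear_functional_scaleD[OF clinear_e]
          sum_distrib_left mult_ac)
    then show ?thesis by (subst sum.swap)
  qed
  ultimately show ?thesis
    by (intro exI[of _ I] exI[of _ c] exI[of _ "\<lambda>i j. e i * \<phi> j x"]) auto
qed

section \<open>The convolution exponential\<close>

text \<open>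
  On matrix coefficients, convolution powers are powers of a fixed matrix.
\<close>

lemma conv_pow_bound:
  assumes f: "clinear f"
  obtains C M where "\<And>n. norm (conv_pow D e f n x) \<le> C * M ^ n"
proof -
  obtain I c \<gamma> where c: "comatrix I c"
    and x: "\<forall>f :: 'c \<Rightarrow> complex. clinear f \<longrightarrow> f x = (\<Sum>i\<in>I. \<Sum>j\<in>I. \<gamma> i j * f (c i j))"
    using combination_of_matrix_coefficients[of x] by (elim exE conjE) (rule that)
  note I = comatrixD(1)[OF c] and e = comatrixD(2)[OF c] and mult = comatrixD(3)[OF c]
    and x = x[rule_format]
  define M where "M = (\<Sum>k\<in>I. \<Sum>j\<in>I. norm (f (c k j)))"
  have M: "M \<ge> 0" "(\<Sum>k\<in>I. norm (f (c k j))) \<le> M" if "j \<in> I" for j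
    unfolding M_def using that I by (auto intro!: sum_nonneg sum_mono member_le_sum)
  have bound: "norm (conv_pow D e f n (c i j)) \<le> M ^ n" if "i \<in> I" "j \<in> I" for n i j
    using that
  proof (induction n arbitrary: i j)
    case 0
    then show ?case by (simp add: e)
  next
    case (Suc n)
    have "norm (conv_pow D e f (Suc n) (c i j)) \<le> (\<Sum>k\<in>I. norm (conv_pow D e f n (c i k)) * norm (f (c k j)))"
      using Suc.prems f by (auto simp: mult norm_mult intro: order_trans[OF norm_sum])
    also have "\<dots> \<le> (\<Sum>k\<in>I. M ^ n * norm (f (c k j)))"
      using Suc by (intro sum_mono mult_right_mono) auto
    also have "\<dots> \<le> M ^ n * M"
      using M Suc.prems by (auto simp flip: sum_distrib_left intro!: mult_left_mono)
    finally show ?case by (simp add: mult.commute)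
  qed
  show thesis
  proof (rule that)
    show "norm (conv_pow D e f n x) \<le> (\<Sum>i\<in>I. \<Sum>j\<in>I. norm (\<gamma> i j)) * M ^ n" for n
      unfolding x[OF clinear_conv_pow[OF f]] sum_distrib_right
      by (intro sum_norm_le) (auto simp: norm_mult bound intro!: mult_left_mono)
  qed
qed

lemma summable_conv_exp:
  assumes f: "clinear f"
  shows "summable (\<lambda>n. norm (conv_pow D e f n x / fact n))"
proof -
  obtain C M where CM: "\<And>n. norm (conv_pow D e f n x) \<le> C * M ^ n"
    using conv_pow_bound[OF f] by metis
  have "summable (\<lambda>n. C * (inverse (fact n) * M ^ n))"
    by (intro summable_mult summable_exp)
  moreover have "norm (norm (conv_pow D e f n x / fact n)) \<le> C * (inverse (fact n) * M ^ n)" for n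
    using CM[of n] by (simp add: norm_divide field_simps)
  ultimately show ?thesis by (rule summable_comparison_test')
qed

lemma conv_exp_sums:
  "clinear f \<Longrightarrow> (\<lambda>n. conv_pow D e f n x / fact n) sums conv_exp D e f x"
  unfolding conv_exp_def by (intro summable_sums summable_norm_cancel[OF summable_conv_exp])

lemma clinear_conv_exp [simp]:
  assumes f: "clinear f"
  shows "clinear (conv_exp D e f)"
proof -
  note lin = clinear_conv_pow[OF f] and sums = conv_exp_sums[OF f]
  have "conv_exp D e f (x + y) = conv_exp D e f x + conv_exp D e f y" for x y
    using sums_add[OF sums[of x] sums[of y]] sums[of "x + y"]
    by (simp add: clinear_addD[OF lin] add_divide_distrib sums_iff)
  moreover have "conv_exp D e f (k *\<^sub>C x) = k * conv_exp D e f x" for k x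
    using sums_mult[OF sums[of x], of k] sums[of "k *\<^sub>C x"]
    by (simp add: clinear_functional_scaleD[OF lin] sums_iff)
  ultimately show ?thesis by (simp add: clinear_iff scaleC_complex_def)
qed

lemma conv_pow_scale:
  assumes f: "clinear f"
  shows "conv_pow D e (\<lambda>a. k * f a) n x = k ^ n * conv_pow D e f n x"
proof (induction n arbitrary: x)
  case (Suc n)
  have "conv_pow D e (\<lambda>a. k * f a) (Suc n) x = k * f (L (conv_pow D e (\<lambda>a. k * f a) n) x)"
    using f by (simp add: conv_eq_L)
  also have "f (L (conv_pow D e (\<lambda>a. k * f a) n) x) = k ^ n * conv_pow D e f n (R f x)"
    using f Suc by (simp add: functional_of_L)
  finally show ?case using f by (simp add: conv_eq_R)
qed simp

lemma conv_exp_tendsto_counit: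
  assumes f: "clinear f"
  shows "((\<lambda>t::real. conv_exp D e (\<lambda>a. complex_of_real t * f a) x) \<longlongrightarrow> e x) (at 0)"
proof -
  define c where "c = (\<lambda>n. conv_pow D e f n x / fact n)"
  have "(\<lambda>n. c n * k ^ n) sums conv_exp D e (\<lambda>a. k * f a) x" for k
    using conv_exp_sums[of "\<lambda>a. k * f a" x] f by (simp add: c_def conv_pow_scale mult.commute)
  then have exp: "conv_exp D e (\<lambda>a. k * f a) x = suminf (\<lambda>n. c n * k ^ n)" "summable (\<lambda>n. c n * k ^ n)" for k
    by (auto simp: sums_iff)
  have "isCont (\<lambda>k. suminf (\<lambda>n. c n * k ^ n)) (complex_of_real 0)"
    using exp(2) by (rule isCont_powser_converges_everywhere)
  then have "isCont (\<lambda>t. suminf (\<lambda>n. c n * complex_of_real t ^ n)) 0"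
    by (intro isCont_o2[of 0 complex_of_real "\<lambda>k. suminf (\<lambda>n. c n * k ^ n)"]) simp_all
  moreover have "suminf (\<lambda>n. c n * 0 ^ n) = e x"
    by (subst powser_zero) (simp add: c_def)
  ultimately show ?thesis by (simp add: exp(1) isCont_def)
qed

lemma conv_exp_zero: "conv_exp D e (\<lambda>_. 0) = e"
proof
  fix x
  have "conv_pow D e (\<lambda>_. 0) n x / fact n = (conv_pow D e e n x / fact n) * 0 ^ n" for n
    using conv_pow_scale[of e 0 n x] by simp
  then show "conv_exp D e (\<lambda>_. 0) x = e x"
    unfolding conv_exp_def by (simp only: powser_zero conv_pow.simps fact_0 div_by_1)
qed

lemma conv_pow_commute:
  assumes "clinear f" "clinear g" "f \<star> g = g \<star> f"
  shows "conv_pow D e f n \<star> g = g \<star> conv_pow D e f n"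
proof (induction n)
  case (Suc n)
  then show ?case using assms by (metis conv_assoc conv_pow.simps(2) clinear_conv_pow)
qed (simp add: assms)

lemma conv_exp_central:
  assumes f: "clinear f" and central: "L f = R f"
  shows "L (conv_exp D e f) = R (conv_exp D e f)"
proof -
  have "(conv_exp D e f \<star> g) x = (g \<star> conv_exp D e f) x" if g: "clinear g" for g x
  proof -
    have "conv_pow D e f n \<star> g = g \<star> conv_pow D e f n" for n
      using conv_pow_commute f g central R_eq_L_iff_central[OF f] by blast
    then have "conv_pow D e f n (R g x) = conv_pow D e f n (L g x)" for n
      using f g by (metis conv_eq_L conv_eq_R clinear_conv_pow)
    then show ?thesis
      using f g by (simp add: conv_eq_R[of _ g] conv_eq_L[of g] conv_exp_def)
  qed
  then show ?thesis
    using f R_eq_L_iff_central[of "conv_exp D e f"] by (auto simp: fun_eq_iff)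
qed

text \<open>
  The binomial formula, normalized by factorials so that it has the shape of a Cauchy product. In the
  induction step, translating by \<open>f\<close> raises the power of \<open>f\<close>, and translating by \<open>g\<close> that of \<open>g\<close>, by
  one; the two contributions to the coefficient \<open>q k\<close> carry the weights \<open>k\<close> and \<open>n + 1 - k\<close>.
\<close>

lemma conv_pow_add:
  assumes f: "clinear f" and g: "clinear g" and comm: "f \<star> g = g \<star> f"
  shows "conv_pow D e (\<lambda>a. f a + g a) n x / fact n
    = (\<Sum>k\<le>n. (conv_pow D e f k \<star> conv_pow D e g (n - k)) x / (fact k * fact (n - k)))"
proof (induction n arbitrary: x)
  case 0
  then show ?case by simp
next
  case (Suc n)
  define F G where "F = conv_pow D e f" and "G = conv_pow D e g"
  have F: "clinear (F k)" "F (Suc k) = F k \<star> f" and G: "clinear (G k)" "G (Suc k) = G k \<star> g" for k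
    using f g by (simp_all add: F_def G_def)
  define q where "q = (\<lambda>k. (F k \<star> G (Suc n - k)) x / (fact k * fact (Suc n - k)))"
  let ?S = "\<lambda>x. conv_pow D e (\<lambda>a. f a + g a) n x / fact n"
  have S: "?S y = (\<Sum>k\<le>n. (F k \<star> G (n - k)) y / (fact k * fact (n - k)))" for y
    using Suc by (simp add: F_def G_def)
  have "(F k \<star> G j) (R f x) = (F (Suc k) \<star> G j) x" for k j
  proof -
    have "(F k \<star> G j) \<star> f = F k \<star> (f \<star> G j)"
      using F G f g comm conv_pow_commute[of g f j] by (simp add: conv_assoc G_def)
    then show ?thesis using F G f by (metis conv_assoc clinear_conv conv_eq_R)
  qed
  then have "?S (R f x) = (\<Sum>k\<le>n. of_nat (Suc k) * q (Suc k))"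
    unfolding S q_def by (intro sum.cong) (auto simp: divide_simps simp del: of_nat_Suc)
  also have "\<dots> = (\<Sum>k\<le>Suc n. of_nat k * q k)"
    by (subst sum.atMost_Suc_shift) simp
  finally have 1: "?S (R f x) = (\<Sum>k\<le>Suc n. of_nat k * q k)" .
  have "(F k \<star> G j) (R g x) = (F k \<star> G (Suc j)) x" for k j
    using F G g by (metis conv_assoc clinear_conv conv_eq_R)
  then have "?S (R g x) = (\<Sum>k\<le>n. of_nat (Suc n - k) * q k)"
    unfolding S q_def by (intro sum.cong) (auto simp: Suc_diff_le divide_simps simp del: of_nat_Suc)
  then have 2: "?S (R g x) = (\<Sum>k\<le>Suc n. of_nat (Suc n - k) * q k)" by simp
  have "conv_pow D e (\<lambda>a. f a + g a) (Suc n) x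
      = conv_pow D e (\<lambda>a. f a + g a) n (R f x) + conv_pow D e (\<lambda>a. f a + g a) n (R g x)"
  proof -
    have lin: "clinear (conv_pow D e (\<lambda>a. f a + g a) n)" using f g by simp
    show ?thesis
      using lin f g by (simp add: conv_eq_L functional_of_L)
  qed
  then have "conv_pow D e (\<lambda>a. f a + g a) (Suc n) x / fact (Suc n)
      = (?S (R f x) + ?S (R g x)) / of_nat (Suc n)"
    by (simp only: fact_Suc add_divide_distrib[symmetric] divide_divide_eq_left mult.commute)
  also have "?S (R f x) + ?S (R g x) = (\<Sum>k\<le>Suc n. of_nat (Suc n) * q k)"
    unfolding 1 2 sum.distrib[symmetric]
    by (intro sum.cong) (auto simp: of_nat_diff algebra_simps)
  also have "\<dots> / of_nat (Suc n) = (\<Sum>k\<le>Suc n. q k)"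
    by (simp flip: sum_distrib_left del: sum.atMost_Suc of_nat_Suc)
  finally show ?case by (simp add: q_def F_def G_def)
qed

text \<open>
  Since \<open>D x\<close> is a finite sum of elementary tensors, this is the Cauchy product of absolutely
  convergent scalar series on each of them.
\<close>

lemma conv_exp_add:
  assumes f: "clinear f" and g: "clinear g" and comm: "f \<star> g = g \<star> f"
  shows "conv_exp D e (\<lambda>a. f a + g a) = conv_exp D e f \<star> conv_exp D e g"
proof
  fix x
  define F G where "F = conv_pow D e f" and "G = conv_pow D e g"
  have lin: "clinear (F k)" "clinear (G k)" for k
    using f g by (simp_all add: F_def G_def)
  have "(\<lambda>n. \<Sum>k\<le>n. functional_tensor (F k) (G (n - k)) z / (fact k * fact (n - k)))
      sums functional_tensor (conv_exp D e f) (conv_exp D e g) z" for z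
  proof (induction z rule: tensor_induct)
    case (elem a b)
    have "(\<lambda>n. \<Sum>k\<le>n. F k a / fact k * (G (n - k) b / fact (n - k)))
        sums (suminf (\<lambda>n. F n a / fact n) * suminf (\<lambda>n. G n b / fact n))"
      unfolding F_def G_def by (intro Cauchy_product_sums summable_conv_exp f g)
    then show ?case
      by (simp add: lin f g) (simp add: conv_exp_def F_def G_def)
  next
    case (add y z)
    from sums_add[OF this] show ?case
      using f g by (simp add: lin clinear_addD[OF clinear_functional_tensor] add_divide_distrib sum.distrib)
  next
    case (scale k z)
    from sums_mult[OF this, of k] show ?case
      using f g by (simp add: lin clinear_functional_scaleD[OF clinear_functional_tensor] sum_distrib_left)
  qed
  from this[of "D x"]
  have "(\<lambda>n. conv_pow D e (\<lambda>a. f a + g a) n x / fact n) sums (conv_exp D e f \<star> conv_exp D e g) x"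
    unfolding conv_pow_add[OF assms] by (simp add: conv_eq_functional_tensor F_def G_def)
  then show "conv_exp D e (\<lambda>a. f a + g a) x = (conv_exp D e f \<star> conv_exp D e g) x"
    by (simp add: conv_exp_def sums_iff)
qed

lemma conv_exp_grouplike:
  assumes "clinear f" "D u = u \<otimes>\<^sub>e u" "e u = 1" "f u = 0"
  shows "conv_exp D e f u = 1"
proof -
  have "conv_pow D e f n u = (if n = 0 then 1 else 0)" for n
    using assms by (cases n) (simp_all add: conv_eq_functional_tensor)
  then have "(\<lambda>n. conv_pow D e f n u / fact n) = (\<lambda>n. if n = 0 then 1 else 0)"
    by (auto simp: fun_eq_iff)
  then show ?thesis
    using sums_single[of 0 "\<lambda>_. 1 :: complex"] by (simp add: conv_exp_def sums_iff)
qed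

lemma conv_exp_hermitian:
  assumes st: "antilinear st" "\<And>a. D (st a) = tensor_star st (D a)" "\<And>a. e (st a) = cnj (e a)"
    and f: "clinear f" "\<And>a. f (st a) = cnj (f a)"
  shows "conv_exp D e f (st a) = cnj (conv_exp D e f a)"
proof -
  have "conv_pow D e f n (st a) = cnj (conv_pow D e f n a)" for n a
    by (induction n arbitrary: a)
      (simp_all add: conv_eq_functional_tensor st f functional_tensor_antilinear)
  then have "(\<lambda>n. cnj (conv_pow D e f n a / fact n)) sums conv_exp D e f (st a)"
    using conv_exp_sums[OF f(1), of "st a"] by simp
  then show ?thesis
    using conv_exp_sums[OF f(1), of a] by (metis sums_cnj sums_unique2)
qed

end

lemma conv_exp_coalgebra_morphism:
  assumes "coalg D e" "coalg D' e'" and f: "clinear f" and h: "clinear h"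
    and D: "\<And>x. (h \<otimes>\<^sub>m h) (D' x) = D (h x)" and e: "e \<circ> h = e'"
  shows "conv_exp D' e' (f \<circ> h) x = conv_exp D e f (h x)"
proof -
  interpret coalg D e by fact
  interpret c': coalg D' e' by fact
  have "conv_pow D' e' (f \<circ> h) n x = conv_pow D e f n (h x)" for n x
  proof (induction n arbitrary: x)
    case 0
    then show ?case using e by (auto simp: fun_eq_iff)
  next
    case (Suc n)
    have "conv_pow D' e' (f \<circ> h) n = conv_pow D e f n \<circ> h"
    proof
      show "conv_pow D' e' (f \<circ> h) n y = (conv_pow D e f n \<circ> h) y" for y
        using Suc[of y] by (simp add: comp_def)
    qed
    then have "conv_pow D' e' (f \<circ> h) (Suc n) x
        = functional_tensor (conv_pow D e f n \<circ> h) (f \<circ> h) (D' x)"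
      unfolding conv_pow.simps c'.conv_eq_functional_tensor by (rule arg_cong)
    also have "\<dots> = conv_pow D e f (Suc n) (h x)"
      unfolding conv_pow.simps conv_eq_functional_tensor D[symmetric]
      by (rule functional_tensor_map[symmetric]) (simp_all add: f h)
    finally show ?case .
  qed
  then show ?thesis unfolding conv_exp_def by (simp only:)
qed

section \<open>One-parameter groups in the convolution algebra\<close>

lemma tendsto_functional_tensor:
  assumes "\<And>t. clinear (F t)" "\<And>t. clinear (G t)" "clinear F'" "clinear G'"
    and "\<And>x. ((\<lambda>t. F t x) \<longlongrightarrow> F' x) A" "\<And>x. ((\<lambda>t. G t x) \<longlongrightarrow> G' x) A"
  shows "((\<lambda>t. functional_tensor (F t) (G t) z) \<longlongrightarrow> functional_tensor F' G' z) A"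
proof (induction z rule: tensor_induct)
  case (elem a b)
  show ?case using assms by (simp add: tendsto_mult)
next
  case (add y z)
  from tendsto_add[OF this] show ?case
    using assms by (simp add: clinear_addD[OF clinear_functional_tensor])
next
  case (scale c z)
  from tendsto_mult_left[OF this, of c] show ?case
    using assms by (simp add: clinear_functional_scaleD[OF clinear_functional_tensor])
qed

lemma has_vector_derivative_functional_tensor:
  assumes "\<And>t. clinear (F t)" "\<And>t. clinear (G t)" "clinear F'" "clinear G'"
    and F: "\<And>x. ((\<lambda>t. F t x) has_vector_derivative F' x) (at s within S)"
    and G: "\<And>x. ((\<lambda>t. G t x) has_vector_derivative G' x) (at s within S)"
  shows "((\<lambda>t. functional_tensor (F t) (G t) z) has_vector_derivative
     functional_tensor (F s) G' z + functional_tensor F' (G s) z) (at s within S)"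
proof (induction z rule: tensor_induct)
  case (elem a b)
  from has_vector_derivative_mult[OF F[of a] G[of b]] show ?case
    using assms by simp
next
  case (add y z)
  from has_vector_derivative_add[OF this] show ?case
    using assms by (simp add: clinear_addD[OF clinear_functional_tensor] algebra_simps)
next
  case (scale c z)
  from has_vector_derivative_mult_right[OF this, of c] show ?case
    using assms by (simp add: clinear_functional_scaleD[OF clinear_functional_tensor] algebra_simps)
qed

context coalg
begin

text \<open>
  Continuity of inversion. On matrix coefficients, the identity \<open>J - e = J \<star> (e - E)\<close> bounds the
  distance \<open>\<eta>\<close> of \<open>J\<close> from the identity matrix by \<open>(K + \<eta>) \<epsilon>\<close>, where \<open>\<epsilon>\<close> is that of \<open>E\<close> and \<open>K\<close> is the norm
  of the identity matrix, in the submultiplicative norm that sums the absolute values of all entries.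
\<close>

lemma conv_inverse_tendsto_counit:
  assumes lin: "\<And>t. clinear (E t)" "\<And>t. clinear (J t)"
    and inv: "\<forall>\<^sub>F t in A. J t \<star> E t = e"
    and lim: "\<And>x. ((\<lambda>t. E t x) \<longlongrightarrow> e x) A"
  shows "((\<lambda>t. J t x) \<longlongrightarrow> e x) A"
proof -
  obtain I c \<gamma> where c: "comatrix I c"
    and x: "\<forall>f :: 'c \<Rightarrow> complex. clinear f \<longrightarrow> f x = (\<Sum>i\<in>I. \<Sum>j\<in>I. \<gamma> i j * f (c i j))"
    using combination_of_matrix_coefficients[of x] by (elim exE conjE) (rule that)
  note I = comatrixD(1)[OF c] and mult = comatrixD(3)[OF c]
  define N where "N = (\<lambda>f :: 'c \<Rightarrow> complex. \<Sum>i\<in>I. \<Sum>j\<in>I. norm (f (c i j)))"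
  define K where "K = N e"
  define \<epsilon> where "\<epsilon> = (\<lambda>t. N (\<lambda>y. e y - E t y))"
  define \<eta> where "\<eta> = (\<lambda>t. N (\<lambda>y. J t y - e y))"
  have N_nonneg: "N f \<ge> 0" for f
    unfolding N_def by (intro sum_nonneg) auto
  have N_submult: "(\<Sum>i\<in>I. \<Sum>j\<in>I. \<Sum>k\<in>I. norm (f (c i k)) * norm (g (c k j))) \<le> N f * N g" for f g
  proof -
    have "(\<Sum>i\<in>I. \<Sum>j\<in>I. \<Sum>k\<in>I. norm (f (c i k)) * norm (g (c k j)))
        = (\<Sum>i\<in>I. \<Sum>k\<in>I. norm (f (c i k)) * (\<Sum>j\<in>I. norm (g (c k j))))"
      by (subst sum.swap) (simp add: sum_distrib_left)
    also have "\<dots> \<le> (\<Sum>i\<in>I. \<Sum>k\<in>I. norm (f (c i k)) * N g)"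
      unfolding N_def using I
      by (intro sum_mono mult_left_mono member_le_sum[of _ I "\<lambda>k. \<Sum>j\<in>I. norm (g (c k j))"])
        (auto intro: sum_nonneg)
    finally show ?thesis by (simp add: N_def sum_distrib_right)
  qed
  have \<epsilon>_lim: "(\<epsilon> \<longlongrightarrow> 0) A"
  proof -
    have "(\<epsilon> \<longlongrightarrow> (\<Sum>i\<in>I. \<Sum>j\<in>I. norm (e (c i j) - e (c i j)))) A"
      unfolding \<epsilon>_def N_def by (intro tendsto_sum tendsto_norm tendsto_diff tendsto_const lim)
    then show ?thesis by simp
  qed
  have \<eta>_bound: "\<eta> t \<le> (K + \<eta> t) * \<epsilon> t" if inv: "J t \<star> E t = e" for t
  proof -
    have "norm (J t (c i j) - e (c i j)) \<le> (\<Sum>k\<in>I. norm (J t (c i k)) * norm (e (c k j) - E t (c k j)))"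
      if "i \<in> I" "j \<in> I" for i j
    proof -
      have "J t (c i j) - e (c i j) = (J t \<star> e) (c i j) - (J t \<star> E t) (c i j)"
        by (simp add: inv lin)
      also have "\<dots> = (\<Sum>k\<in>I. J t (c i k) * (e (c k j) - E t (c k j)))"
        using that lin by (simp only: mult clinear_e sum_subtractf[symmetric] right_diff_distrib)
      finally show ?thesis
        by (simp add: norm_mult[symmetric] order_trans[OF norm_sum])
    qed
    then have "\<eta> t \<le> (\<Sum>i\<in>I. \<Sum>j\<in>I. \<Sum>k\<in>I. norm (J t (c i k)) * norm (e (c k j) - E t (c k j)))"
      unfolding \<eta>_def N_def by (intro sum_mono)
    also have "\<dots> \<le> N (J t) * \<epsilon> t"
      unfolding \<epsilon>_def by (rule N_submult)
    also have "N (J t) \<le> K + \<eta> t"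
      unfolding N_def K_def \<eta>_def sum.distrib[symmetric]
      by (intro sum_mono) (metis add.commute diff_add_cancel norm_triangle_ineq)
    finally show ?thesis
      using N_nonneg by (simp add: mult_right_mono \<epsilon>_def)
  qed
  have "\<forall>\<^sub>F t in A. \<eta> t \<le> 2 * K * \<epsilon> t"
  proof -
    have "\<forall>\<^sub>F t in A. \<epsilon> t < 1 / 2"
      using \<epsilon>_lim by (rule order_tendstoD) simp
    then show ?thesis
      using inv
    proof eventually_elim
      case (elim t)
      have "\<eta> t * \<epsilon> t \<le> \<eta> t * (1 / 2)"
        using elim N_nonneg by (intro mult_left_mono) (auto simp: \<eta>_def)
      then show ?case
        using \<eta>_bound[OF elim(2)] by (simp add: algebra_simps)
    qed
  qed
  moreover have "((\<lambda>t. 2 * K * \<epsilon> t) \<longlongrightarrow> 0) A"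
    using tendsto_mult_left[OF \<epsilon>_lim, of "2 * K"] by simp
  ultimately have \<eta>_lim: "(\<eta> \<longlongrightarrow> 0) A"
    using N_nonneg by (intro tendsto_sandwich[of "\<lambda>_. 0" \<eta> A "\<lambda>t. 2 * K * \<epsilon> t"]) (auto simp: \<eta>_def)
  have "((\<lambda>t. J t (c i j)) \<longlongrightarrow> e (c i j)) A" if ij: "i \<in> I" "j \<in> I" for i j
  proof -
    have "norm (J t (c i j) - e (c i j)) \<le> \<eta> t" for t
    proof -
      have "norm (J t (c i j) - e (c i j)) \<le> (\<Sum>j\<in>I. norm (J t (c i j) - e (c i j)))"
        using I ij by (intro member_le_sum) auto
      also have "\<dots> \<le> \<eta> t"
        unfolding \<eta>_def N_def using I ij
        by (intro member_le_sum[of i I "\<lambda>i. \<Sum>j\<in>I. norm (J t (c i j) - e (c i j))"])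
          (auto intro: sum_nonneg)
      finally show ?thesis .
    qed
    then have "((\<lambda>t. J t (c i j) - e (c i j)) \<longlongrightarrow> 0) A"
      by (intro Lim_null_comparison[OF _ \<eta>_lim]) simp
    then show ?thesis by (simp add: Lim_null[symmetric])
  qed
  then show ?thesis
    using x lin by (simp add: x[rule_format] tendsto_sum tendsto_mult_left)
qed

text \<open>
  The integrals \<open>F h = (\<integral> s = 0..h. E s)\<close> smooth the group: \<open>E t \<star> F h\<close> is the integral of \<open>E\<close> over
  \<open>[t, t + h]\<close> and hence differentiable in \<open>t\<close>. So the subspace \<open>V\<close> of those \<open>y\<close> for which \<open>E t y\<close> is
  differentiable at \<open>0\<close> contains all \<open>R (F h) y\<close>. If \<open>V\<close> missed some \<open>x\<close>, a functional \<open>\<phi>\<close> vanishing on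
  \<open>V\<close> with \<open>\<phi> x = 1\<close> would give \<open>(\<phi> \<star> F h) x = 0\<close> for all \<open>h \<ge> 0\<close>, but the derivative of this function
  of \<open>h\<close> at \<open>0\<close> is \<open>(\<phi> \<star> e) x = 1\<close>.
\<close>

lemma convolution_group_differentiable:
  assumes lin: "\<And>t. clinear (E t)" and add: "\<And>s t. E (s + t) = E s \<star> E t"
    and zero: "E 0 = e" and lim: "\<And>x. ((\<lambda>t::real. E t x) \<longlongrightarrow> e x) (at 0)"
  shows "\<exists>d. ((\<lambda>t. E t x) has_vector_derivative d) (at 0)"
proof -
  have cont: "continuous_on S (\<lambda>t. E t y)" for S y
  proof (rule continuous_at_imp_continuous_on, rule ballI)
    fix s
    have "((\<lambda>t. E (s + t) y) \<longlongrightarrow> (E s \<star> e) y) (at 0)"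
      unfolding add conv_eq_functional_tensor
      by (intro tendsto_functional_tensor lin clinear_e lim tendsto_const)
    then show "isCont (\<lambda>t. E t y) s"
      by (simp add: isCont_iff lin)
  qed
  note int = integrable_continuous_real[OF cont]
  define F where "F = (\<lambda>h y. integral {0..h} (\<lambda>s. E s y))"
  have F_lin: "clinear (F h)" for h
    unfolding F_def using int
    by (simp add: clinear_iff clinear_addD[OF lin] clinear_functional_scaleD[OF lin]
        Henstock_Kurzweil_Integration.integral_add scaleC_complex_def)
  define V where "V = {y. \<exists>d. ((\<lambda>t. E t y) has_vector_derivative d) (at 0)}"
  have "cvec.subspace V"
    unfolding cvec.subspace_def V_def
    by (auto simp: clinear_zeroD[OF lin] clinear_addD[OF lin] clinear_functional_scaleD[OF lin]
        intro: has_vector_derivative_add has_vector_derivative_mult_right has_vector_derivative_const)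
  have F_in_V: "R (F h) y \<in> V" if "h \<ge> 0" for h y
  proof -
    let ?f = "\<lambda>s. E s y"
    \<comment> \<open>The base point lies below \<open>0\<close> so that \<open>P\<close> is differentiable at \<open>0\<close> from both sides.\<close>
    define P where "P = (\<lambda>a. integral {-1..a} ?f)"
    have P: "(P has_vector_derivative ?f a) (at a)" if "a > -1" for a
    proof -
      have "(P has_vector_derivative ?f a) (at a within {-1..a + 1})"
        unfolding P_def using that by (intro integral_has_vector_derivative cont) auto
      then show ?thesis
        using that at_within_Icc_at[of "-1" a "a + 1"] by simp
    qed
    have shift: "P (h + t) - P t = E t (R (F h) y)" if "t \<in> {-1<..}" for t
    proof -
      have "E t (R (F h) y) = F h (L (E t) y)"
        using lin F_lin by (simp add: functional_of_L)
      also have "\<dots> = integral {0..h} (\<lambda>s. ?f (s + t))"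
        unfolding F_def add[of t, symmetric] using lin
        by (simp add: conv_eq_L[symmetric] add[symmetric] add.commute)
      also have "\<dots> = integral {t..h + t} ?f"
        using integral_shift_real_ivl[of t t "h + t" ?f] by simp
      also have "\<dots> = P (h + t) - P t"
        using Henstock_Kurzweil_Integration.integral_combine[of "-1" t "h + t" ?f] int that \<open>h \<ge> 0\<close>
        by (simp add: P_def algebra_simps)
      finally show ?thesis ..
    qed
    have "((\<lambda>t. P (h + t) - P t) has_vector_derivative ?f h - ?f 0) (at 0)"
    proof (intro has_vector_derivative_diff P)
      have "((P \<circ> (\<lambda>t. h + t)) has_vector_derivative 1 *\<^sub>R ?f (h + 0)) (at 0)"
        using that by (intro vector_diff_chain_at P) (auto intro!: derivative_eq_intros)
      then show "((\<lambda>t. P (h + t)) has_vector_derivative ?f h) (at 0)"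
        by (simp add: comp_def)
    qed auto
    then have "((\<lambda>t. E t (R (F h) y)) has_vector_derivative ?f h - ?f 0) (at 0)"
    proof (rule has_vector_derivative_transform_within_open)
      show "open {-1::real<..}" "0 \<in> {-1::real<..}" by simp_all
    qed (rule shift)
    then show ?thesis by (auto simp: V_def)
  qed
  have "x \<in> V"
  proof (rule ccontr)
    assume "x \<notin> V"
    obtain \<phi> :: "'c \<Rightarrow> complex"
      where \<phi>: "clinear \<phi>" "\<And>y. y \<in> V \<Longrightarrow> \<phi> y = 0" "\<phi> x = 1"
      using functional_vanishing_on_subspace[OF \<open>cvec.subspace V\<close> \<open>x \<notin> V\<close>] by metis
    have zero_lin: "clinear (\<lambda>_::'c. 0::complex)" by (simp add: clinear_iff)
    have "((\<lambda>h. F h y) has_vector_derivative e y) (at 0 within {0..1})" for y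
      using integral_has_vector_derivative[OF cont, of 0 0 1 y] by (simp add: F_def zero)
    then have "((\<lambda>h. functional_tensor \<phi> (F h) (D x)) has_vector_derivative
        functional_tensor \<phi> e (D x) + functional_tensor (\<lambda>_. 0) (F 0) (D x)) (at 0 within {0..1})"
      by (intro has_vector_derivative_functional_tensor[of "\<lambda>_. \<phi>" F "\<lambda>_. 0" e]
          \<phi> F_lin zero_lin clinear_e has_vector_derivative_const)
    moreover have "functional_tensor \<phi> e (D x) = 1"
      using conv_eq_functional_tensor[of \<phi> e x] \<phi>(1,3) by simp
    moreover have "functional_tensor (\<lambda>_. 0) (F 0) (D x) = 0"
      using conv_eq_functional_tensor[of "\<lambda>_. 0" "F 0" x] conv_eq_R[OF zero_lin F_lin] by simp
    ultimately have "((\<lambda>h. functional_tensor \<phi> (F h) (D x)) has_vector_derivative 1) (at 0 within {0..1})"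
      by simp
    moreover have "0 = functional_tensor \<phi> (F h) (D x)" if "h \<in> {0..1}" for h
      using \<phi>(2)[OF F_in_V[of h x]] that conv_eq_functional_tensor[of \<phi> "F h" x]
        conv_eq_R[OF \<phi>(1) F_lin] by simp
    ultimately have "((\<lambda>_. 0 :: complex) has_vector_derivative 1) (at (0::real) within {0..1})"
      by (intro has_vector_derivative_transform[of 0 "{0..1}" "\<lambda>_. 0" "\<lambda>h. functional_tensor \<phi> (F h) (D x)" 1]) auto
    then show False
      using vector_derivative_unique_within_closed_interval[of 0 1 0 "\<lambda>_. 0 :: complex" 1 0] by simp
  qed
  then show ?thesis by (simp add: V_def)
qed

end

section \<open>Transport of algebra structures\<close>

text \<open>
  Surjectivity of \<open>\<Phi>\<close> turns each axiom for \<open>m'\<close> into the image under \<open>\<Phi>\<close> of the axiom for \<open>m\<close>.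
\<close>

lemma algebra_iso_transport:
  assumes alg: "unital_algebra m u" and \<Phi>: "clinear \<Phi>" "bij \<Phi>" and m': "clinear m'"
    and hom: "\<Phi> \<circ> m = m' \<circ> (\<Phi> \<otimes>\<^sub>m \<Phi>)"
  shows "algebra_iso m u m' (\<Phi> u) \<Phi>"
proof -
  have m: "clinear m" and assoc: "m (m (a \<otimes>\<^sub>e b) \<otimes>\<^sub>e c) = m (a \<otimes>\<^sub>e m (b \<otimes>\<^sub>e c))"
    and unit: "m (u \<otimes>\<^sub>e a) = a" "m (a \<otimes>\<^sub>e u) = a" for a b c
  proof -
    show m: "clinear m" and "m (u \<otimes>\<^sub>e a) = a" "m (a \<otimes>\<^sub>e u) = a"
      using alg by (simp_all add: unital_algebra_def)
    have "(m \<circ> (m \<otimes>\<^sub>m id)) ((a \<otimes>\<^sub>e b) \<otimes>\<^sub>e c) = (m \<circ> (id \<otimes>\<^sub>m m) \<circ> tensor_assoc) ((a \<otimes>\<^sub>e b) \<otimes>\<^sub>e c)"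
      using alg by (simp only: unital_algebra_def)
    then show "m (m (a \<otimes>\<^sub>e b) \<otimes>\<^sub>e c) = m (a \<otimes>\<^sub>e m (b \<otimes>\<^sub>e c))" using m by simp
  qed
  have hom': "m' (\<Phi> a \<otimes>\<^sub>e \<Phi> b) = \<Phi> (m (a \<otimes>\<^sub>e b))" for a b
    using fun_cong[OF hom, of "a \<otimes>\<^sub>e b"] \<Phi> by simp
  have \<Phi>_inv: "\<Phi> (inv \<Phi> a) = a" for a
    using \<Phi> by (simp add: bij_is_surj surj_f_inv_f)
  have assoc': "m' (m' (a \<otimes>\<^sub>e b) \<otimes>\<^sub>e c) = m' (a \<otimes>\<^sub>e m' (b \<otimes>\<^sub>e c))" for a b c
    using arg_cong[OF assoc[of "inv \<Phi> a" "inv \<Phi> b" "inv \<Phi> c"], of \<Phi>]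
    by (simp only: hom'[symmetric] \<Phi>_inv)
  have "(m' \<circ> (m' \<otimes>\<^sub>m id)) z = (m' \<circ> (id \<otimes>\<^sub>m m') \<circ> tensor_assoc) z" for z
    using clinear_eq_on_left_tensors[of "m' \<circ> (m' \<otimes>\<^sub>m id)" "m' \<circ> (id \<otimes>\<^sub>m m') \<circ> tensor_assoc" z]
    by (simp add: m' assoc')
  moreover have "m' (\<Phi> u \<otimes>\<^sub>e a) = a \<and> m' (a \<otimes>\<^sub>e \<Phi> u) = a" for a
    using hom'[of u "inv \<Phi> a"] hom'[of "inv \<Phi> a" u] by (simp only: unit \<Phi>_inv)
  ultimately show ?thesis
    using assms by (simp add: algebra_iso_def unital_algebra_def fun_eq_iff)
qed

lemma star_algebra_transport:
  assumes star: "star_algebra m u st" and iso: "algebra_iso m u m' u' \<Phi>"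
    and hermitian: "\<And>a. \<Phi> (st a) = st (\<Phi> a)"
  shows "star_algebra_iso m u st m' u' st \<Phi>"
proof -
  have \<Phi>: "clinear \<Phi>" "bij \<Phi>" and hom: "\<Phi> \<circ> m = m' \<circ> (\<Phi> \<otimes>\<^sub>m \<Phi>)"
    using iso by (simp_all add: algebra_iso_def)
  have hom': "m' (\<Phi> a \<otimes>\<^sub>e \<Phi> b) = \<Phi> (m (a \<otimes>\<^sub>e b))" for a b
    using fun_cong[OF hom, of "a \<otimes>\<^sub>e b"] \<Phi> by simp
  have \<Phi>_inv: "\<Phi> (inv \<Phi> a) = a" for a
    using \<Phi> by (simp add: bij_is_surj surj_f_inv_f)
  have anti: "st (m (a \<otimes>\<^sub>e b)) = m (st b \<otimes>\<^sub>e st a)" for a b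
    using star by (simp add: star_algebra_def)
  have "st (m' (a \<otimes>\<^sub>e b)) = m' (st b \<otimes>\<^sub>e st a)" for a b
    using arg_cong[OF anti[of "inv \<Phi> a" "inv \<Phi> b"], of \<Phi>]
    by (simp only: hermitian hom'[symmetric] \<Phi>_inv)
  then show ?thesis
    using star iso hermitian by (simp add: star_algebra_iso_def star_algebra_def algebra_iso_def)
qed

lemma clinear_inv:
  assumes "clinear \<Phi>" "bij \<Phi>"
  shows "clinear (inv \<Phi>)"
proof -
  have inv: "inv \<Phi> (\<Phi> a) = a" "\<Phi> (inv \<Phi> b) = b" for a b
    using assms by (simp_all add: bij_is_inj bij_is_surj surj_f_inv_f)
  then show ?thesis
    using assms(1) unfolding clinear_iff by metis
qed

section \<open>Deformations generated by coboundaries\<close>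

context coalg
begin

lemma conv_scale:
  "clinear f \<Longrightarrow> clinear g \<Longrightarrow> (\<lambda>a. k * f a) \<star> g = (\<lambda>a. k * (f \<star> g) a)"
  "clinear f \<Longrightarrow> clinear g \<Longrightarrow> f \<star> (\<lambda>a. k * g a) = (\<lambda>a. k * (f \<star> g) a)"
  by (rule ext, simp add: conv_eq_R) (rule ext, simp add: conv_eq_L)

lemma centralD: "clinear f \<Longrightarrow> L f = R f \<Longrightarrow> clinear g \<Longrightarrow> g \<star> f = f \<star> g"
  using R_eq_L_iff_central[of f] by simp

lemma central_scale:
  assumes "clinear f" "L f = R f"
  shows "L (\<lambda>a. k * f a) = R (\<lambda>a. k * f a)"
  using assms R_eq_L_iff_central[of f] R_eq_L_iff_central[of "\<lambda>a. k * f a"] by (simp add: conv_scale)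

lemma central_add:
  assumes f: "clinear f" "L f = R f" and g: "clinear g" "L g = R g"
  shows "L (\<lambda>a. f a + g a) = R (\<lambda>a. f a + g a)"
proof -
  have "(\<lambda>a. f a + g a) \<star> h = h \<star> (\<lambda>a. f a + g a)" if h: "clinear h" for h
  proof
    fix x
    have "((\<lambda>a. f a + g a) \<star> h) x = (f \<star> h) x + (g \<star> h) x"
      using f g h by (simp add: conv_eq_R)
    also have "\<dots> = (h \<star> (\<lambda>a. f a + g a)) x"
      using f g h R_eq_L_iff_central[of f] R_eq_L_iff_central[of g] by (simp add: conv_eq_L)
    finally show "((\<lambda>a. f a + g a) \<star> h) x = (h \<star> (\<lambda>a. f a + g a)) x" .
  qed
  then show ?thesis using f g R_eq_L_iff_central[of "\<lambda>a. f a + g a"] by simp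
qed

end

locale bialg =
  fixes m :: "'b::complex_vector \<otimes> 'b \<Rightarrow> 'b" and u :: 'b and D :: "'b \<Rightarrow> 'b \<otimes> 'b" and e :: "'b \<Rightarrow> complex"
  assumes bialgebra: "bialgebra m u D e"

sublocale bialg \<subseteq> coalg D e
  by unfold_locales (use bialgebra in \<open>simp add: bialgebra_def\<close>)

sublocale bialg \<subseteq> sq: coalg "comult2 D" "counit2 e"
  by unfold_locales (rule coalgebra_tensor_square)

context bialg
begin

lemma unital_algebra: "unital_algebra m u" and D_u: "D u = u \<otimes>\<^sub>e u" and e_u [simp]: "e u = 1"
  and D_m: "D (m z) = (m \<otimes>\<^sub>m m) (D2 z)" and e_m: "e \<circ> m = e2"
  using bialgebra by (auto simp: bialgebra_def fun_eq_iff)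

lemma clinear_m [simp]: "clinear m"
  using unital_algebra by (simp add: unital_algebra_def)

lemma R_unit: "clinear f \<Longrightarrow> R f u = f u *\<^sub>C u"
  by (simp add: convolution_def D_u)

lemma square_translations:
  assumes "clinear f" "clinear g"
  shows "sq.R (functional_tensor f g) = R f \<otimes>\<^sub>m R g" "sq.L (functional_tensor f g) = L f \<otimes>\<^sub>m L g"
  using convolution_tensor_maps[OF assms] by (simp_all add: fun_eq_iff convolution_def[of D2])

lemma conv_functional_tensor:
  assumes "clinear f" "clinear g" "clinear f'" "clinear g'"
  shows "sq.conv (functional_tensor f g) (functional_tensor f' g') = functional_tensor (f \<star> f') (g \<star> g')"
proof
  fix z
  have "f \<circ> R f' = f \<star> f'" "g \<circ> R g' = g \<star> g'"
    using assms by (simp_all add: fun_eq_iff conv_eq_R)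
  then show "sq.conv (functional_tensor f g) (functional_tensor f' g') z = functional_tensor (f \<star> f') (g \<star> g') z"
    using assms by (simp add: sq.conv_eq_R square_translations functional_tensor_map)
qed

text \<open>
  Already the convolution powers satisfy \<open>(f \<otimes> e)\<^sup>n = f\<^sup>n \<otimes> e\<close>, because \<open>e\<close> is the unit.
\<close>

lemma conv_exp_functional_tensor_counit:
  assumes f: "clinear f"
  shows "conv_exp D2 e2 (functional_tensor f e) = functional_tensor (conv_exp D e f) e"
    and "conv_exp D2 e2 (functional_tensor e f) = functional_tensor e (conv_exp D e f)"
proof -
  note lin = clinear_conv_pow[OF f]
  have pow: "conv_pow D2 e2 (functional_tensor f e) n = functional_tensor (conv_pow D e f n) e"
    "conv_pow D2 e2 (functional_tensor e f) n = functional_tensor e (conv_pow D e f n)" for n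
  proof (induction n)
    case 0
    show "conv_pow D2 e2 (functional_tensor f e) 0 = functional_tensor (conv_pow D e f 0) e"
      "conv_pow D2 e2 (functional_tensor e f) 0 = functional_tensor e (conv_pow D e f 0)"
      by (simp_all only: conv_pow.simps counit2_eq)
  next
    case (Suc n)
    show "conv_pow D2 e2 (functional_tensor f e) (Suc n) = functional_tensor (conv_pow D e f (Suc n)) e"
      "conv_pow D2 e2 (functional_tensor e f) (Suc n) = functional_tensor e (conv_pow D e f (Suc n))"
      by (simp_all only: conv_pow.simps Suc conv_functional_tensor lin f clinear_e conv_counit)
  qed
  have left: "conv_exp D2 e2 (functional_tensor f e) (a \<otimes>\<^sub>e b) = functional_tensor (conv_exp D e f) e (a \<otimes>\<^sub>e b)" for a b
  proof (rule sums_unique2)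
    show "(\<lambda>n. conv_pow D2 e2 (functional_tensor f e) n (a \<otimes>\<^sub>e b) / fact n)
        sums conv_exp D2 e2 (functional_tensor f e) (a \<otimes>\<^sub>e b)"
      by (rule sq.conv_exp_sums) (simp add: f)
    show "(\<lambda>n. conv_pow D2 e2 (functional_tensor f e) n (a \<otimes>\<^sub>e b) / fact n)
        sums functional_tensor (conv_exp D e f) e (a \<otimes>\<^sub>e b)"
      using sums_mult2[OF conv_exp_sums[OF f, of a], of "e b"] by (simp add: pow lin f)
  qed
  have right: "conv_exp D2 e2 (functional_tensor e f) (a \<otimes>\<^sub>e b) = functional_tensor e (conv_exp D e f) (a \<otimes>\<^sub>e b)" for a b
  proof (rule sums_unique2)
    show "(\<lambda>n. conv_pow D2 e2 (functional_tensor e f) n (a \<otimes>\<^sub>e b) / fact n)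
        sums conv_exp D2 e2 (functional_tensor e f) (a \<otimes>\<^sub>e b)"
      by (rule sq.conv_exp_sums) (simp add: f)
    show "(\<lambda>n. conv_pow D2 e2 (functional_tensor e f) n (a \<otimes>\<^sub>e b) / fact n)
        sums functional_tensor e (conv_exp D e f) (a \<otimes>\<^sub>e b)"
      using sums_mult[OF conv_exp_sums[OF f, of b], of "e a"] by (simp add: pow lin f)
  qed
  show "conv_exp D2 e2 (functional_tensor f e) = functional_tensor (conv_exp D e f) e"
    by (rule clinear_tensor_ext) (simp_all only: left clinear_functional_tensor clinear_conv_exp sq.clinear_conv_exp clinear_e f)
  show "conv_exp D2 e2 (functional_tensor e f) = functional_tensor e (conv_exp D e f)"
    by (rule clinear_tensor_ext) (simp_all only: right clinear_functional_tensor clinear_conv_exp sq.clinear_conv_exp clinear_e f)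
qed

text \<open>
  \<open>f \<otimes> e\<close> and \<open>e \<otimes> f\<close> commute, with product \<open>f \<otimes> f\<close>.
\<close>

lemma conv_exp_derivation:
  assumes f: "clinear f"
  shows "conv_exp D2 e2 (\<lambda>z. functional_tensor f e z + functional_tensor e f z)
    = functional_tensor (conv_exp D e f) (conv_exp D e f)"
proof -
  have "conv_exp D2 e2 (\<lambda>z. functional_tensor f e z + functional_tensor e f z)
    = sq.conv (functional_tensor (conv_exp D e f) e) (functional_tensor e (conv_exp D e f))"
    using f by (subst sq.conv_exp_add)
      (simp_all add: conv_functional_tensor conv_exp_functional_tensor_counit)
  then show ?thesis using f by (simp add: conv_functional_tensor)
qed

text \<open>
  The multiplication is a morphism of coalgebras, so translations pass through it.
\<close>

lemma R_m:
  assumes f: "clinear f"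
  shows "R f (m z) = m (sq.R (f \<circ> m) z)"
proof -
  have "scalar_right ((m \<otimes>\<^sub>m (f \<circ> m)) w) = m (scalar_right ((id \<otimes>\<^sub>m (f \<circ> m)) w))" for w
    using clinear_eq_on_tensors[of "scalar_right \<circ> (m \<otimes>\<^sub>m (f \<circ> m))" "m \<circ> scalar_right \<circ> (id \<otimes>\<^sub>m (f \<circ> m))" w] f
    by (simp add: clinear_scaleD[OF clinear_m])
  then show ?thesis
    using f by (simp add: convolution_def D_m tensor_map_map)
qed

lemma convolution_product:
  assumes X: "clinear X"
  shows "convolution D2 scalar_right m X z = m (sq.R X z)"
proof -
  have "scalar_right ((m \<otimes>\<^sub>m X) w) = m (scalar_right ((id \<otimes>\<^sub>m X) w))" for w
    using clinear_eq_on_tensors[of "scalar_right \<circ> (m \<otimes>\<^sub>m X)" "m \<circ> scalar_right \<circ> (id \<otimes>\<^sub>m X)" w] X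
    by (simp add: clinear_scaleD[OF clinear_m])
  then show ?thesis by (simp add: convolution_def)
qed

lemma coboundary_eq:
  assumes \<psi>: "clinear \<psi>"
  shows "coboundary m e \<psi> z = functional_tensor e \<psi> z - \<psi> (m z) + functional_tensor \<psi> e z"
    and "clinear (coboundary m e \<psi>)"
proof -
  have "bisemilinear id (\<lambda>a b. e a * \<psi> b - \<psi> (m (a \<otimes>\<^sub>e b)) + \<psi> a * e b)"
    using clinear_m clinear_e \<psi>
    by (simp add: clinear_iff bisemilinear_def tensor_elem_add_left tensor_elem_add_right
        tensor_elem_scale_left tensor_elem_scale_right scaleC_complex_def algebra_simps)
  then show lin: "clinear (coboundary m e \<psi>)"
    by (subst clinear_iff) (simp add: coboundary_def tensor_lift_add tensor_lift_scale)
  have "clinear (\<lambda>z. functional_tensor e \<psi> z - \<psi> (m z) + functional_tensor \<psi> e z)"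
    using clinear_functional_add[OF clinear_functional_add[of "functional_tensor e \<psi>" "\<lambda>z. - (\<psi> \<circ> m) z"],
        of "functional_tensor \<psi> e"] clinear_functional_uminus[of "\<psi> \<circ> m"] \<psi> by simp
  then show "coboundary m e \<psi> z = functional_tensor e \<psi> z - \<psi> (m z) + functional_tensor \<psi> e z"
    by (rule clinear_eq_on_tensors[OF lin]) (simp add: coboundary_elem \<psi>)
qed

end

locale commuting_cochain = bialg m u D e
  for m :: "'b::complex_vector \<otimes> 'b \<Rightarrow> 'b" and u D e +
  fixes \<psi> :: "'b \<Rightarrow> complex"
  assumes \<psi>: "\<psi> \<in> C1_NC u D"
begin

definition E :: "real \<Rightarrow> 'b \<Rightarrow> complex" where
  "E t = conv_exp D e (\<lambda>a. - complex_of_real t * \<psi> a)"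

abbreviation deformed :: "real \<Rightarrow> 'b \<otimes> 'b \<Rightarrow> 'b" where
  "deformed t \<equiv> convolution D2 scalar_right m
     (conv_exp D2 e2 (\<lambda>x. complex_of_real t * coboundary m e \<psi> x))"

lemma clinear_\<psi> [simp]: "clinear \<psi>" and \<psi>_unit: "\<psi> u = 0" and \<psi>_central: "L \<psi> = R \<psi>"
  using \<psi> by (simp_all add: C1_NC_def)

lemma clinear_exponent [simp]: "clinear (\<lambda>a. - complex_of_real t * \<psi> a)"
  using clinear_functional_mult[OF clinear_\<psi>] .

lemma clinear_E [simp]: "clinear (E t)"
  unfolding E_def by (rule clinear_conv_exp) simp

lemma E_add: "E (s + t) = E s \<star> E t"
proof -
  have "(\<lambda>a. - complex_of_real (s + t) * \<psi> a)
      = (\<lambda>a. - complex_of_real s * \<psi> a + - complex_of_real t * \<psi> a)"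
    by (simp add: fun_eq_iff algebra_simps)
  moreover have "(\<lambda>a. - complex_of_real s * \<psi> a) \<star> (\<lambda>a. - complex_of_real t * \<psi> a)
      = (\<lambda>a. - complex_of_real t * \<psi> a) \<star> (\<lambda>a. - complex_of_real s * \<psi> a)"
    using conv_scale[of \<psi> "\<lambda>a. - complex_of_real t * \<psi> a" "- complex_of_real s"]
      conv_scale[of "\<lambda>a. - complex_of_real t * \<psi> a" \<psi> "- complex_of_real s"]
      conv_scale[of \<psi> \<psi> "- complex_of_real t"] by simp
  ultimately show ?thesis by (simp only: E_def conv_exp_add clinear_exponent)
qed

lemma E_0: "E 0 = e"
  using conv_exp_zero by (simp add: E_def)

lemma E_lim: "((\<lambda>t. E t x) \<longlongrightarrow> e x) (at 0)"
  using conv_exp_tendsto_counit[of "\<lambda>a. - \<psi> a" x] by (simp add: E_def)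

lemma E_central: "L (E t) = R (E t)"
  unfolding E_def using conv_exp_central[OF clinear_exponent] central_scale[OF clinear_\<psi> \<psi>_central] by blast

lemma R_E_add: "R (E s) \<circ> R (E t) = R (E (s + t))"
  by (simp add: fun_eq_iff R_R E_add)

lemma bij_R_E: "bij (R (E t))"
  by (rule o_bij[of "R (E (- t))"]) (simp_all only: R_E_add add.right_inverse add.left_inverse E_0 R_counit)

lemma linear_semigroup_R_E: "linear_semigroup (\<lambda>t. R (E t))"
  by (simp add: linear_semigroup_def R_E_add) (simp only: E_0 R_counit)

lemma pointwise_continuous_R_E: "pointwise_continuous (\<lambda>t. R (E t))"
  unfolding pointwise_continuous_def
proof (intro allI impI)
  fix b and f :: "'b \<Rightarrow> complex" assume f: "clinear f"
  have "((\<lambda>t. (f \<star> E t) b) \<longlongrightarrow> (f \<star> e) b) (at_right 0)"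
    unfolding conv_eq_functional_tensor
    by (intro tendsto_functional_tensor f clinear_E clinear_e tendsto_const
        tendsto_mono[OF at_le[OF subset_UNIV] E_lim])
  then show "((\<lambda>t. f (R (E t) b)) \<longlongrightarrow> f b) (at_right 0)"
    using f by (simp add: conv_eq_R)
qed

lemma R_E_unit: "R (E t) u = u"
proof -
  have "E t u = 1"
    unfolding E_def by (rule conv_exp_grouplike[OF clinear_exponent D_u e_u]) (simp add: \<psi>_unit)
  then show ?thesis by (simp add: R_unit scaleC_one)
qed

lemma R_E_commutes: "(R (E t) \<otimes>\<^sub>m id) \<circ> D = (id \<otimes>\<^sub>m R (E t)) \<circ> D"
  by (simp add: fun_eq_iff R_tensor_L E_central)

text \<open>
  The multiplicativity of \<open>R (E t)\<close>, reduced to an identity of functionals on the tensor square: it is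
  the exponential of \<open>- t \<psi> \<circ> m = t \<partial>\<psi> + P\<close>, with \<open>P = - t (\<psi> \<otimes> e + e \<otimes> \<psi>)\<close> central.
\<close>

lemma exp_comp_m:
  "E t \<circ> m = sq.conv (conv_exp D2 e2 (\<lambda>x. complex_of_real t * coboundary m e \<psi> x)) (functional_tensor (E t) (E t))"
proof -
  let ?f = "\<lambda>a. - complex_of_real t * \<psi> a"
  let ?L = "\<lambda>x. complex_of_real t * coboundary m e \<psi> x"
  let ?P = "\<lambda>z. functional_tensor ?f e z + functional_tensor e ?f z"
  have lin: "clinear ?L" "clinear ?P"
    by (simp_all add: coboundary_eq(2))
  have f_central: "L ?f = R ?f"
    by (rule central_scale) (simp_all add: \<psi>_central)
  have P_central: "sq.L ?P = sq.R ?P"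
    by (rule sq.central_add) (simp_all only: square_translations clinear_e clinear_exponent
        clinear_functional_tensor f_central R_counit L_counit)
  have comm: "sq.conv ?L ?P = sq.conv ?P ?L"
    by (rule sq.centralD[OF lin(2) P_central lin(1)])
  have scale: "functional_tensor ?f e z = - complex_of_real t * functional_tensor \<psi> e z"
    "functional_tensor e ?f z = - complex_of_real t * functional_tensor e \<psi> z" for z
    using clinear_eq_on_tensors[of "functional_tensor ?f e" "\<lambda>z. - complex_of_real t * functional_tensor \<psi> e z" z]
      clinear_eq_on_tensors[of "functional_tensor e ?f" "\<lambda>z. - complex_of_real t * functional_tensor e \<psi> z" z]
    by simp_all
  have sum: "?f \<circ> m = (\<lambda>z. ?L z + ?P z)"
    unfolding scale coboundary_eq(1)[OF clinear_\<psi>] by (simp add: fun_eq_iff algebra_simps)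
  have "E t \<circ> m = conv_exp D2 e2 (?f \<circ> m)"
    using conv_exp_coalgebra_morphism[OF coalg_axioms sq.coalg_axioms clinear_exponent[of t] clinear_m D_m[symmetric] e_m]
    by (simp add: fun_eq_iff E_def)
  also have "\<dots> = sq.conv (conv_exp D2 e2 ?L) (conv_exp D2 e2 ?P)"
    unfolding sum by (rule sq.conv_exp_add[OF lin comm])
  also have "conv_exp D2 e2 ?P = functional_tensor (E t) (E t)"
    unfolding E_def by (rule conv_exp_derivation) simp
  finally show ?thesis .
qed

lemma algebra_iso_R_E: "algebra_iso m u (deformed t) u (R (E t))"
proof -
  let ?X = "conv_exp D2 e2 (\<lambda>x. complex_of_real t * coboundary m e \<psi> x)"
  have X: "clinear ?X" by (simp add: coboundary_eq(2))
  have "R (E t) \<circ> m = deformed t \<circ> (R (E t) \<otimes>\<^sub>m R (E t))"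
  proof
    fix z
    have "(R (E t) \<circ> m) z = m (sq.R (sq.conv ?X (functional_tensor (E t) (E t))) z)"
      using R_m[of "E t"] by (simp add: exp_comp_m)
    also have "\<dots> = m (sq.R ?X ((R (E t) \<otimes>\<^sub>m R (E t)) z))"
      using X by (simp add: sq.R_R[symmetric] square_translations)
    finally show "(R (E t) \<circ> m) z = (deformed t \<circ> (R (E t) \<otimes>\<^sub>m R (E t))) z"
      using X by (simp add: convolution_product)
  qed
  moreover have "clinear (deformed t)"
    using X by (simp add: convolution_def)
  ultimately show ?thesis
    using algebra_iso_transport[OF unital_algebra _ bij_R_E[of t], of "deformed t"] by (simp add: R_E_unit)
qed

lemma star_algebra_iso_R_E:
  assumes star: "star_bialgebra m u D e st" and hermitian: "\<And>a. \<psi> a = cnj (\<psi> (st a))"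
  shows "star_algebra_iso m u st (deformed t) u st (R (E t))"
proof (rule star_algebra_transport[OF _ algebra_iso_R_E])
  show "star_algebra m u st" using star by (simp add: star_bialgebra_def)
  then have st: "antilinear st" by (simp add: star_algebra_def)
  have D: "D (st a) = tensor_star st (D a)" and e: "e (st a) = cnj (e a)" for a
    using star by (simp_all add: star_bialgebra_def)
  have \<psi>: "\<psi> (st a) = cnj (\<psi> a)" for a
    using arg_cong[OF hermitian[of a], of cnj] by simp
  have E: "E t (st a) = cnj (E t a)" for a
    unfolding E_def by (rule conv_exp_hermitian[OF st D e clinear_exponent]) (simp add: \<psi>)
  define S :: "'b \<otimes> 'b \<Rightarrow> 'b" where "S = scalar_right \<circ> (id \<otimes>\<^sub>m E t)"
  have S: "S (x + y) = S x + S y" "S (k *\<^sub>C x) = k *\<^sub>C S x" "S (a \<otimes>\<^sub>e b) = E t b *\<^sub>C a" for x y k a b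
    using clinear_addD[of S x y] clinear_scaleD[of S k x] by (simp_all add: S_def)
  have st_simps: "st (x + y) = st x + st y" "st (k *\<^sub>C x) = cnj k *\<^sub>C st x"
    "tensor_star st (y' + z) = tensor_star st y' + tensor_star st z"
    "tensor_star st (k *\<^sub>C z) = cnj k *\<^sub>C tensor_star st z" for x y k y' z
    using st antilinear_tensor_star[OF st] by (simp_all add: antilinear_def)
  have "S (tensor_star st z) = st (S z)" for z
    by (induction z rule: tensor_induct) (simp_all add: tensor_star_elem st E S st_simps)
  then show "R (E t) (st a) = st (R (E t) a)" for a
    by (simp add: convolution_def D S_def)
qed

end

section \<open>Deformations from commuting semigroups\<close>

text \<open>
  Extending the semigroup to negative times lets the convolution group be treated with two-sided limits
  and derivatives, and puts the inverse maps that occur in the deformed product on the same footing.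
\<close>

definition two_sided :: "(real \<Rightarrow> 'a \<Rightarrow> 'a) \<Rightarrow> real \<Rightarrow> 'a \<Rightarrow> 'a" where
  "two_sided \<Phi> t = (if t \<ge> 0 then \<Phi> t else inv (\<Phi> (- t)))"

lemma two_sided_add:
  assumes add: "\<And>s t. s \<ge> 0 \<Longrightarrow> t \<ge> 0 \<Longrightarrow> \<Phi> s \<circ> \<Phi> t = \<Phi> (s + t)"
    and bij: "\<And>t. t \<ge> 0 \<Longrightarrow> bij (\<Phi> t)"
  shows "two_sided \<Phi> s \<circ> two_sided \<Phi> t = two_sided \<Phi> (s + t)"
proof -
  have cancel: "\<Phi> r \<circ> inv (\<Phi> r) = id" "inv (\<Phi> r) \<circ> \<Phi> r = id" if "r \<ge> 0" for r
    using bij[OF that] by (simp_all add: bij_is_inj bij_is_surj flip: surj_iff inj_iff)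
  have inv_add: "inv (\<Phi> (q + r)) = inv (\<Phi> r) \<circ> inv (\<Phi> q)" if "q \<ge> 0" "r \<ge> 0" for q r
    using that o_inv_distrib[OF bij bij] by (metis add)
  have right: "\<Phi> q \<circ> inv (\<Phi> r) = two_sided \<Phi> (q - r)" if "q \<ge> 0" "r \<ge> 0" for q r
  proof (cases "q \<ge> r")
    case True
    then have "\<Phi> q = \<Phi> (q - r) \<circ> \<Phi> r" using add[of "q - r" r] that by simp
    then show ?thesis using True that cancel by (simp add: comp_assoc two_sided_def)
  next
    case False
    then have "inv (\<Phi> r) = inv (\<Phi> q) \<circ> inv (\<Phi> (r - q))" using inv_add[of "r - q" q] that by simp
    then show ?thesis using False that cancel[of q] by (simp add: two_sided_def flip: comp_assoc)
  qed
  have left: "inv (\<Phi> r) \<circ> \<Phi> q = two_sided \<Phi> (q - r)" if "q \<ge> 0" "r \<ge> 0" for q r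
  proof (cases "q \<ge> r")
    case True
    then have "\<Phi> q = \<Phi> r \<circ> \<Phi> (q - r)" using add[of r "q - r"] that by simp
    then show ?thesis using True that cancel[of r] by (simp add: two_sided_def flip: comp_assoc)
  next
    case False
    then have "inv (\<Phi> r) = inv (\<Phi> (r - q)) \<circ> inv (\<Phi> q)" using inv_add[of q "r - q"] that by simp
    then show ?thesis using False that cancel[of q] by (simp add: two_sided_def comp_assoc)
  qed
  consider "s \<ge> 0" "t \<ge> 0" | "s \<ge> 0" "t < 0" | "s < 0" "t \<ge> 0" | "s < 0" "t < 0"
    by linarith
  then show ?thesis
  proof cases
    case 1
    then show ?thesis by (simp add: two_sided_def add)
  next
    case 2
    then show ?thesis using right[of s "- t"] by (simp add: two_sided_def[of _ s] two_sided_def[of _ t])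
  next
    case 3
    then show ?thesis using left[of t "- s"]
      by (simp add: two_sided_def[of _ s] two_sided_def[of _ t] add.commute)
  next
    case 4
    then show ?thesis using inv_add[of "- t" "- s"] by (simp add: two_sided_def add.commute)
  qed
qed

locale commuting_semigroup = bialg m u D e
  for m :: "'b::complex_vector \<otimes> 'b \<Rightarrow> 'b" and u D e +
  fixes \<Phi> :: "real \<Rightarrow> 'b \<Rightarrow> 'b"
  assumes semigroup: "linear_semigroup \<Phi>" and continuous: "pointwise_continuous \<Phi>"
    and bij: "\<And>t. t \<ge> 0 \<Longrightarrow> bij (\<Phi> t)" and unit: "\<And>t. t \<ge> 0 \<Longrightarrow> \<Phi> t u = u"
    and commutes: "\<And>t. t \<ge> 0 \<Longrightarrow> (\<Phi> t \<otimes>\<^sub>m id) \<circ> D = (id \<otimes>\<^sub>m \<Phi> t) \<circ> D"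
begin

definition G :: "real \<Rightarrow> 'b \<Rightarrow> 'b" where "G = two_sided \<Phi>"

lemma \<Phi>_lin: "t \<ge> 0 \<Longrightarrow> clinear (\<Phi> t)" and \<Phi>_0: "\<Phi> 0 = id"
  and \<Phi>_add: "s \<ge> 0 \<Longrightarrow> t \<ge> 0 \<Longrightarrow> \<Phi> s \<circ> \<Phi> t = \<Phi> (s + t)"
  using semigroup by (simp_all add: linear_semigroup_def)

lemma G_add: "G s \<circ> G t = G (s + t)"
  unfolding G_def by (rule two_sided_add[OF \<Phi>_add bij])

lemma G_0: "G 0 = id"
  by (simp add: G_def two_sided_def \<Phi>_0)

lemma G_nonneg: "t \<ge> 0 \<Longrightarrow> G t = \<Phi> t" and G_nonpos: "t \<ge> 0 \<Longrightarrow> G (- t) = inv (\<Phi> t)"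
  by (auto simp: G_def two_sided_def \<Phi>_0 order_antisym)

lemma G_cases: obtains r where "r \<ge> 0" "G t = \<Phi> r" | r where "r \<ge> 0" "G t = inv (\<Phi> r)"
  using that(1)[of t] that(2)[of "- t"] G_nonneg[of t] G_nonpos[of "- t"] by (cases "t \<ge> 0") simp_all

lemma clinear_G [simp]: "clinear (G t)"
  by (cases rule: G_cases[of t]) (simp_all add: \<Phi>_lin bij clinear_inv)

lemma G_inverse: "G t (G (- t) x) = x" "G (- t) (G t x) = x"
  using G_add[of t "- t"] G_add[of "- t" t] by (simp_all add: G_0 fun_eq_iff)

lemma bij_G: "bij (G t)"
  by (rule o_bij[of "G (- t)"]) (simp_all add: fun_eq_iff G_inverse)

lemma G_unit: "G t u = u"
proof (cases rule: G_cases[of t])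
  case (2 r)
  then show ?thesis using unit[of r] bij[of r] by (metis bij_is_inj inv_f_f)
qed (simp add: unit)

lemma G_commutes: "(G t \<otimes>\<^sub>m id) \<circ> D = (id \<otimes>\<^sub>m G t) \<circ> D"
proof (cases rule: G_cases[of t])
  case (1 r)
  then show ?thesis by (simp add: commutes)
next
  case (2 r)
  have lin: "clinear (\<Phi> r)" "clinear (inv (\<Phi> r))" and bij: "bij (\<Phi> r)"
    using 2(1) by (simp_all add: \<Phi>_lin bij clinear_inv)
  have inv: "inv (\<Phi> r) \<circ> \<Phi> r = id"
    using bij by (simp add: bij_is_inj flip: inj_iff)
  have "(inv (\<Phi> r) \<otimes>\<^sub>m id) (D x) = (id \<otimes>\<^sub>m inv (\<Phi> r)) (D x)" for x
    using arg_cong[OF fun_cong[OF commutes[OF 2(1)], of x], of "inv (\<Phi> r) \<otimes>\<^sub>m inv (\<Phi> r)"]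
    by (simp add: tensor_map_map lin inv)
  then show ?thesis by (simp add: fun_eq_iff 2(2))
qed

definition E :: "real \<Rightarrow> 'b \<Rightarrow> complex" where "E t = e \<circ> G t"

lemma clinear_E [simp]: "clinear (E t)"
  by (simp add: E_def)

lemma R_E: "R (E t) = G t" and L_E: "L (E t) = G t"
  unfolding E_def using commuting_map_eq_translation[OF clinear_G G_commutes] by auto

lemma E_add: "E (s + t) = E s \<star> E t"
proof
  show "E (s + t) x = (E s \<star> E t) x" for x
    by (simp add: conv_eq_R R_E) (simp add: E_def flip: G_add)
qed

lemma E_0: "E 0 = e"
  by (simp add: E_def G_0)

text \<open>
  From the right this is the assumed continuity, from the left it is continuity of inversion.
\<close>

lemma E_lim: "((\<lambda>t. E t x) \<longlongrightarrow> e x) (at 0)"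
proof -
  have right: "((\<lambda>t. E t x) \<longlongrightarrow> e x) (at_right 0)" for x
  proof (rule Lim_transform_eventually)
    show "((\<lambda>t. e (\<Phi> t x)) \<longlongrightarrow> e x) (at_right 0)"
      using continuous clinear_e by (simp add: pointwise_continuous_def)
    show "\<forall>\<^sub>F t in at_right 0. e (\<Phi> t x) = E t x"
      using eventually_at_right_less[of 0] by eventually_elim (simp add: E_def G_nonneg)
  qed
  have "((\<lambda>t. E (- t) x) \<longlongrightarrow> e x) (at_right 0)"
    by (rule conv_inverse_tendsto_counit[OF _ _ _ right])
      (simp_all add: E_0 flip: E_add)
  then show ?thesis
    using right by (simp add: filterlim_at_split filterlim_at_left_to_right)
qed

definition \<psi> :: "'b \<Rightarrow> complex" where "\<psi> x = - vector_derivative (\<lambda>t. E t x) (at 0)"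

lemma E_deriv: "((\<lambda>t. E t x) has_vector_derivative - \<psi> x) (at 0)"
proof -
  obtain d where "((\<lambda>t. E t x) has_vector_derivative d) (at 0)"
    using convolution_group_differentiable[OF clinear_E E_add E_0 E_lim] by blast
  then show ?thesis by (simp add: \<psi>_def vector_derivative_at)
qed

lemma clinear_\<psi> [simp]: "clinear \<psi>"
proof -
  have "- \<psi> (x + y) = - (\<psi> x + \<psi> y)" for x y
  proof (rule vector_derivative_unique_at[OF E_deriv])
    show "((\<lambda>t. E t (x + y)) has_vector_derivative - (\<psi> x + \<psi> y)) (at 0)"
      unfolding clinear_addD[OF clinear_E] minus_add_distrib by (rule has_vector_derivative_add[OF E_deriv E_deriv])
  qed
  moreover have "- \<psi> (k *\<^sub>C x) = k * - \<psi> x" for k x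
  proof (rule vector_derivative_unique_at[OF E_deriv])
    show "((\<lambda>t. E t (k *\<^sub>C x)) has_vector_derivative k * - \<psi> x) (at 0)"
      unfolding clinear_functional_scaleD[OF clinear_E] by (rule has_vector_derivative_mult_right[OF E_deriv])
  qed
  ultimately have "\<psi> (x + y) = \<psi> x + \<psi> y" "\<psi> (k *\<^sub>C x) = k * \<psi> x" for x y k
    using neg_equal_iff_equal by (blast, simp)
  then show ?thesis by (simp add: clinear_iff scaleC_complex_def)
qed

lemma E_minus_deriv: "((\<lambda>t. E (- t) x) has_vector_derivative \<psi> x) (at 0)"
proof -
  have "(((\<lambda>t. E t x) \<circ> uminus) has_vector_derivative (- 1) *\<^sub>R (- \<psi> x)) (at 0)"
    using E_deriv by (intro vector_diff_chain_at) (auto intro!: derivative_eq_intros)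
  then show ?thesis by (simp add: comp_def)
qed

lemma \<psi>_cochain: "\<psi> \<in> C1_NC u D"
proof -
  have "\<psi> u = 0"
    by (simp add: \<psi>_def E_def G_unit)
  moreover have "L \<psi> = R \<psi>"
  proof -
    have "(\<psi> \<star> g) x = (g \<star> \<psi>) x" if g: "clinear g" for g x
    proof -
      have "(\<psi> \<star> g) x = \<psi> (R g x)" "(g \<star> \<psi>) x = \<psi> (L g x)"
        using g by (simp_all add: conv_eq_R[of \<psi>] conv_eq_L[of g])
      moreover have "E t (R g x) = E t (L g x)" for t
        using g by (simp flip: conv_eq_R conv_eq_L) (simp add: conv_eq_R[of g] conv_eq_L[of _ g] R_E L_E)
      ultimately show ?thesis by (simp add: \<psi>_def)
    qed
    then show ?thesis using R_eq_L_iff_central[OF clinear_\<psi>] by (auto simp: fun_eq_iff)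
  qed
  ultimately show ?thesis by (simp add: C1_NC_def)
qed

text \<open>
  For \<open>t \<ge> 0\<close> this is the deformed multiplication.
\<close>

definition M :: "real \<Rightarrow> 'b \<otimes> 'b \<Rightarrow> 'b" where
  "M t = G t \<circ> m \<circ> (G (- t) \<otimes>\<^sub>m G (- t))"

lemma M_0: "M 0 = m"
  by (simp add: M_def G_0)

lemma M_iso: "algebra_iso m u (M t) u (G t)"
proof -
  have "(G (- t) \<otimes>\<^sub>m G (- t)) ((G t \<otimes>\<^sub>m G t) z) = z" for z
    using G_add[of "- t" t] by (simp add: tensor_map_map G_0)
  then have "G t \<circ> m = M t \<circ> (G t \<otimes>\<^sub>m G t)"
    by (simp add: M_def fun_eq_iff)
  then show ?thesis
    using algebra_iso_transport[OF unital_algebra clinear_G bij_G, of "M t"] by (simp add: M_def G_unit)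
qed

text \<open>
  The comultiplication splits the group parameter: \<open>G s = L (E s)\<close> acts on the left leg and
  \<open>G t = R (E t)\<close> on the right one.
\<close>

lemma D_G: "D (G (s + t) x) = (G s \<otimes>\<^sub>m G t) (D x)"
proof -
  have "D (G s (G t x)) = (G s \<otimes>\<^sub>m id) ((id \<otimes>\<^sub>m G t) (D x))"
    using D_L[of "E s" "G t x"] D_R[of "E t" x] by (simp only: R_E L_E clinear_E)
  then show ?thesis
    by (simp add: tensor_map_map flip: G_add)
qed

text \<open>
  Both the outer map \<open>G (t + s)\<close> and the inner maps \<open>G (- (t + s))\<close> are split by the comultiplication
  into their \<open>t\<close> and \<open>s\<close> parts; the flip in the comultiplication of the tensor square collects them.
\<close>

lemma M_add: "D \<circ> M (t + s) = (M t \<otimes>\<^sub>m M s) \<circ> D2"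
proof
  fix z
  define w where "w = (G (- (t + s)) \<otimes>\<^sub>m G (- (t + s))) z"
  have "D \<circ> G (- (t + s)) = (G (- t) \<otimes>\<^sub>m G (- s)) \<circ> D"
    using D_G[of "- t" "- s"] by (simp add: fun_eq_iff)
  then have "(D \<otimes>\<^sub>m D) w
      = ((G (- t) \<otimes>\<^sub>m G (- s)) \<otimes>\<^sub>m (G (- t) \<otimes>\<^sub>m G (- s))) ((D \<otimes>\<^sub>m D) z)"
    unfolding w_def by (simp only: tensor_map_map clinear_G clinear_D clinear_tensor_map)
  then have "D2 w = ((G (- t) \<otimes>\<^sub>m G (- t)) \<otimes>\<^sub>m (G (- s) \<otimes>\<^sub>m G (- s))) (D2 z)"
    by (simp add: comult2_def middle_flip_tensor_map)
  then have "D (m w) = (m \<otimes>\<^sub>m m) (((G (- t) \<otimes>\<^sub>m G (- t)) \<otimes>\<^sub>m (G (- s) \<otimes>\<^sub>m G (- s))) (D2 z))"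
    by (simp only: D_m)
  moreover have "(D \<circ> M (t + s)) z = (G t \<otimes>\<^sub>m G s) (D (m w))"
    unfolding M_def w_def by (simp add: D_G)
  ultimately show "(D \<circ> M (t + s)) z = ((M t \<otimes>\<^sub>m M s) \<circ> D2) z"
    by (simp add: tensor_map_map M_def comp_assoc)
qed

text \<open>
  The product rule applied to \<open>e \<circ> M t = (E t \<circ> m) \<star> J t\<close> with \<open>J t = E (- t) \<otimes> E (- t)\<close>.
\<close>

lemma M_deriv: "((\<lambda>t. e (M t x)) has_vector_derivative coboundary m e \<psi> x) (at 0)"
proof -
  define J where "J = (\<lambda>t. functional_tensor (E (- t)) (E (- t)))"
  define J' where "J' = (\<lambda>z. functional_tensor e \<psi> z + functional_tensor \<psi> e z)"
  have lin: "clinear (J t)" "clinear J'" "clinear (\<lambda>z. - \<psi> (m z))" for t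
    using clinear_functional_uminus[of "\<psi> \<circ> m"] by (simp_all add: J_def J'_def)
  have "e (M t x) = functional_tensor (E t \<circ> m) (J t) (D2 x)" for t
    using sq.conv_eq_R[of "E t \<circ> m" "J t" x] lin
    by (simp add: sq.conv_eq_functional_tensor M_def E_def[of t])
      (simp add: J_def square_translations R_E)
  moreover have J_deriv: "((\<lambda>t. J t z) has_vector_derivative J' z) (at 0)" for z
    using has_vector_derivative_functional_tensor[OF _ _ _ _ E_minus_deriv E_minus_deriv, where z = z]
    by (simp add: J_def J'_def E_0)
  have "((\<lambda>t. (E t \<circ> m) z) has_vector_derivative - \<psi> (m z)) (at 0)" for z
    using E_deriv by simp
  from has_vector_derivative_functional_tensor[OF clinear_comp[OF clinear_m clinear_E] lin(1) lin(3) lin(2) this J_deriv,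
      where z = "D2 x"]
  have "((\<lambda>t. functional_tensor (E t \<circ> m) (J t) (D2 x)) has_vector_derivative
      functional_tensor (E 0 \<circ> m) J' (D2 x) + functional_tensor (\<lambda>z. - \<psi> (m z)) (J 0) (D2 x)) (at 0)" .
  moreover have "functional_tensor (E 0 \<circ> m) J' (D2 x) = J' x"
    using sq.conv_counit(2)[OF lin(2)] by (simp only: sq.conv_eq_functional_tensor[symmetric] E_0 e_m)
  moreover have "functional_tensor (\<lambda>z. - \<psi> (m z)) (J 0) (D2 x) = - \<psi> (m x)"
    using sq.conv_counit(1)[OF lin(3)]
    by (simp only: sq.conv_eq_functional_tensor[symmetric] J_def minus_zero E_0 counit2_eq[symmetric])
  ultimately show ?thesis
    by (simp add: coboundary_eq(1) J'_def algebra_simps)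
qed

lemma deformation:
  assumes \<mu>: "\<mu> = (\<lambda>t. \<Phi> t \<circ> m \<circ> (inv (\<Phi> t) \<otimes>\<^sub>m inv (\<Phi> t)))"
  shows "additive_deformation m u D e \<mu>" and "has_generator e \<mu> (coboundary m e \<psi>)"
    and "star_bialgebra m u D e st \<Longrightarrow> (\<And>t b. t \<ge> 0 \<Longrightarrow> \<Phi> t (st b) = st (\<Phi> t b)) \<Longrightarrow>
      star_additive_deformation m u D e st \<mu> \<and> \<psi> \<in> C1_NCH u D st"
proof -
  have \<mu>: "\<mu> t = M t" if "t \<ge> 0" for t
    using that by (simp add: \<mu> M_def G_nonneg G_nonpos)
  have lim: "((\<lambda>t. e (\<mu> t x)) \<longlongrightarrow> e2 x) (at_right 0)" for x
  proof (rule Lim_transform_eventually)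
    have "((\<lambda>t. e (M t x)) \<longlongrightarrow> e (M 0 x)) (at 0)"
      using has_vector_derivative_continuous[OF M_deriv] by (simp add: isCont_def)
    then show "((\<lambda>t. e (M t x)) \<longlongrightarrow> e2 x) (at_right 0)"
      using e_m by (simp add: M_0 filterlim_at_split fun_eq_iff)
    show "\<forall>\<^sub>F t in at_right 0. e (M t x) = e (\<mu> t x)"
      using eventually_at_right_less[of 0] by eventually_elim (simp add: \<mu>)
  qed
  show additive: "additive_deformation m u D e \<mu>"
    using lim M_add M_iso M_0 by (simp add: additive_deformation_def \<mu> algebra_iso_def)
  show "has_generator e \<mu> (coboundary m e \<psi>)"
    unfolding has_generator_def
  proof
    show "((\<lambda>t. e (\<mu> t x)) has_vector_derivative coboundary m e \<psi> x) (at 0 within {0..})" for x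
      by (rule has_vector_derivative_transform[OF _ _ has_vector_derivative_at_within[OF M_deriv]])
        (simp_all add: \<mu>)
  qed
  assume star: "star_bialgebra m u D e st" and hermitian: "\<And>t b. t \<ge> 0 \<Longrightarrow> \<Phi> t (st b) = st (\<Phi> t b)"
  have e_st: "e (st a) = cnj (e a)" for a
    using star by (simp add: star_bialgebra_def)
  have "star_algebra (\<mu> t) u st" if "t \<ge> 0" for t
    using star_algebra_transport[OF _ M_iso, of st t] star hermitian that
    by (simp add: star_bialgebra_def star_algebra_iso_def \<mu> G_nonneg)
  moreover have "\<psi> a = cnj (\<psi> (st a))" for a
  proof -
    have "((\<lambda>t. cnj (E t a)) has_vector_derivative cnj (- \<psi> a)) (at 0 within cbox 0 1)"
      by (rule bounded_linear.has_vector_derivative[OF bounded_linear_cnj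
            has_vector_derivative_at_within[OF E_deriv]])
    then have 1: "((\<lambda>t. E t (st a)) has_vector_derivative cnj (- \<psi> a)) (at 0 within cbox 0 1)"
      by (rule has_vector_derivative_transform[rotated 2])
        (simp_all add: E_def G_nonneg hermitian e_st)
    have "cnj (- \<psi> a) = - \<psi> (st a)"
      by (rule vector_derivative_unique_within_closed_interval[OF _ _ 1
            has_vector_derivative_at_within[OF E_deriv]]) simp_all
    from arg_cong[OF this, of cnj] show ?thesis by simp
  qed
  ultimately show "star_additive_deformation m u D e st \<mu> \<and> \<psi> \<in> C1_NCH u D st"
    using star additive \<psi>_cochain unfolding star_additive_deformation_def C1_NCH_def by blast
qed

end

section \<open>The correspondence\<close>

theorem theorem2:
  fixes m :: "'b::complex_vector \<otimes> 'b \<Rightarrow> 'b"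
    and u :: 'b
    and D :: "'b \<Rightarrow> 'b \<otimes> 'b"
    and e :: "'b \<Rightarrow> complex"
  assumes "bialgebra m u D e"
  shows
    "(\<forall>L \<psi> \<Phi> \<mu>.
        L \<in> B2_NC m u D e \<and> \<psi> \<in> C1_NC u D \<and> L = coboundary m e \<psi> \<and>
        \<Phi> = (\<lambda>t::real. convolution D scalar_right id
               (conv_exp D e (\<lambda>a. - complex_of_real t * \<psi> a))) \<and>
        \<mu> = (\<lambda>t::real. convolution (comult2 D) scalar_right m
               (conv_exp (comult2 D) (counit2 e) (\<lambda>x. complex_of_real t * L x)))
        \<longrightarrow>
        linear_semigroup \<Phi> \<and> pointwise_continuous \<Phi> \<and>
        (\<forall>t\<ge>0. algebra_iso m u (\<mu> t) u (\<Phi> t)) \<and>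
        (\<forall>t\<ge>0. (\<Phi> t \<otimes>\<^sub>m id) \<circ> D = (id \<otimes>\<^sub>m \<Phi> t) \<circ> D)) \<and>
     (\<forall>st L. star_bialgebra m u D e st \<and> L \<in> B2_NCH m u D e st \<longrightarrow>
        (\<exists>\<psi>. \<psi> \<in> C1_NCH u D st \<and> L = coboundary m e \<psi>) \<and>
        (\<forall>\<psi> \<Phi> \<mu>.
           \<psi> \<in> C1_NCH u D st \<and> L = coboundary m e \<psi> \<and>
           \<Phi> = (\<lambda>t::real. convolution D scalar_right id
                  (conv_exp D e (\<lambda>a. - complex_of_real t * \<psi> a))) \<and>
           \<mu> = (\<lambda>t::real. convolution (comult2 D) scalar_right m
                  (conv_exp (comult2 D) (counit2 e) (\<lambda>x. complex_of_real t * L x)))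
           \<longrightarrow>
           (\<forall>t\<ge>0. star_algebra_iso m u st (\<mu> t) u st (\<Phi> t)))) \<and>
     (\<forall>\<Phi> \<mu>.
        linear_semigroup \<Phi> \<and> pointwise_continuous \<Phi> \<and>
        (\<forall>t\<ge>0. bij (\<Phi> t)) \<and> (\<forall>t\<ge>0. \<Phi> t u = u) \<and>
        (\<forall>t\<ge>0. (\<Phi> t \<otimes>\<^sub>m id) \<circ> D = (id \<otimes>\<^sub>m \<Phi> t) \<circ> D) \<and>
        \<mu> = (\<lambda>t::real. \<Phi> t \<circ> m \<circ> (inv (\<Phi> t) \<otimes>\<^sub>m inv (\<Phi> t)))
        \<longrightarrow>
        additive_deformation m u D e \<mu> \<and>
        (\<exists>L. has_generator e \<mu> L \<and> L \<in> B2_NC m u D e \<and>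
          (\<forall>st. star_bialgebra m u D e st \<and> (\<forall>t\<ge>0. \<forall>b. \<Phi> t (st b) = st (\<Phi> t b)) \<longrightarrow>
             star_additive_deformation m u D e st \<mu> \<and> L \<in> B2_NCH m u D e st)))"
proof -
  interpret bialg m u D e by unfold_locales fact
  have A: "linear_semigroup \<Phi> \<and> pointwise_continuous \<Phi> \<and> (\<forall>t\<ge>0. algebra_iso m u (\<mu> t) u (\<Phi> t)) \<and>
      (\<forall>t\<ge>0. (\<Phi> t \<otimes>\<^sub>m id) \<circ> D = (id \<otimes>\<^sub>m \<Phi> t) \<circ> D)"
    and A_star: "star_bialgebra m u D e st \<Longrightarrow> \<psi> \<in> C1_NCH u D st \<Longrightarrow> star_algebra_iso m u st (\<mu> t) u st (\<Phi> t)"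
    if \<psi>: "\<psi> \<in> C1_NC u D" and L: "L = coboundary m e \<psi>"
      and \<Phi>: "\<Phi> = (\<lambda>t::real. R (conv_exp D e (\<lambda>a. - complex_of_real t * \<psi> a)))"
      and \<mu>: "\<mu> = (\<lambda>t::real. convolution D2 scalar_right m (conv_exp D2 e2 (\<lambda>x. complex_of_real t * L x)))"
    for L \<psi> \<Phi> \<mu> st t
  proof -
    interpret commuting_cochain m u D e \<psi> by unfold_locales fact
    have \<Phi>: "\<Phi> = (\<lambda>t. R (E t))" and \<mu>: "\<mu> = deformed"
      unfolding \<Phi> \<mu> L E_def by (rule refl)+
    show "linear_semigroup \<Phi> \<and> pointwise_continuous \<Phi> \<and> (\<forall>t\<ge>0. algebra_iso m u (\<mu> t) u (\<Phi> t)) \<and>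
        (\<forall>t\<ge>0. (\<Phi> t \<otimes>\<^sub>m id) \<circ> D = (id \<otimes>\<^sub>m \<Phi> t) \<circ> D)"
      unfolding \<Phi> \<mu>
      by (intro conjI allI impI linear_semigroup_R_E pointwise_continuous_R_E algebra_iso_R_E R_E_commutes)
    show "star_algebra_iso m u st (\<mu> t) u st (\<Phi> t)"
      if star: "star_bialgebra m u D e st" and herm: "\<psi> \<in> C1_NCH u D st"
      unfolding \<Phi> \<mu> by (rule star_algebra_iso_R_E[OF star]) (use herm in \<open>unfold C1_NCH_def, blast\<close>)
  qed
  have B: "additive_deformation m u D e \<mu> \<and> (\<exists>L. has_generator e \<mu> L \<and> L \<in> B2_NC m u D e \<and>
      (\<forall>st. star_bialgebra m u D e st \<and> (\<forall>t\<ge>0. \<forall>b. \<Phi> t (st b) = st (\<Phi> t b)) \<longrightarrow>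
         star_additive_deformation m u D e st \<mu> \<and> L \<in> B2_NCH m u D e st))"
    if "linear_semigroup \<Phi>" "pointwise_continuous \<Phi>" "\<forall>t\<ge>0. bij (\<Phi> t)" "\<forall>t\<ge>0. \<Phi> t u = u"
      "\<forall>t\<ge>0. (\<Phi> t \<otimes>\<^sub>m id) \<circ> D = (id \<otimes>\<^sub>m \<Phi> t) \<circ> D"
      and \<mu>: "\<mu> = (\<lambda>t::real. \<Phi> t \<circ> m \<circ> (inv (\<Phi> t) \<otimes>\<^sub>m inv (\<Phi> t)))"
    for \<Phi> \<mu>
  proof -
    interpret commuting_semigroup m u D e \<Phi> by unfold_locales (use that in auto)
    note def = deformation[OF \<mu>]
    have "coboundary m e \<psi> \<in> B2_NC m u D e"
      using \<psi>_cochain by (simp add: B2_NC_def)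
    moreover have "star_additive_deformation m u D e st \<mu> \<and> coboundary m e \<psi> \<in> B2_NCH m u D e st"
      if "star_bialgebra m u D e st \<and> (\<forall>t\<ge>0. \<forall>b. \<Phi> t (st b) = st (\<Phi> t b))" for st
      using def(3)[of st] that by (simp add: B2_NCH_def)
    ultimately show ?thesis using def(1,2) by blast
  qed
  show ?thesis
  proof (rule conjI[OF _ conjI], goal_cases)
    case 1
    show ?case by (intro allI impI, elim conjE) (rule A; assumption)
  next
    case 2
    show ?case
    proof (intro allI impI conjI; elim conjE)
      fix st L assume "L \<in> B2_NCH m u D e st"
      then show "\<exists>\<psi>. \<psi> \<in> C1_NCH u D st \<and> L = coboundary m e \<psi>"
        unfolding B2_NCH_def by blast
    next
      fix st and L \<psi> \<Phi> \<mu> and t :: real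
      assume "star_bialgebra m u D e st" "\<psi> \<in> C1_NCH u D st" "L = coboundary m e \<psi>"
        "\<Phi> = (\<lambda>t::real. R (conv_exp D e (\<lambda>a. - complex_of_real t * \<psi> a)))"
        "\<mu> = (\<lambda>t::real. convolution D2 scalar_right m (conv_exp D2 e2 (\<lambda>x. complex_of_real t * L x)))"
      moreover from this have "\<psi> \<in> C1_NC u D" unfolding C1_NCH_def by blast
      ultimately show "star_algebra_iso m u st (\<mu> t) u st (\<Phi> t)"
        by (intro A_star)
    qed
  next
    case 3
    show ?case by (intro allI impI, elim conjE) (rule B; assumption)
  qed
qed
end
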